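(* Let $X$ be a complex Banach space and let $T\in\mathcal L(X)$. Then $$\operatorname{conv}\sigma_e(T)\subset W_e(T).$$
   Context: $\mathcal L(X)$ is the algebra of bounded linear operators on $X$, $\mathcal K(X)$ is the ideal of compact operators, and $\pi:\mathcal L(X)\to\mathcal L(X)/\mathcal K(X)$ is the quotient map. The essential spectrum of $T$ is $\sigma_e(T):=\sigma(\pi(T),\mathcal L(X)/\mathcal K(X))$, the spectrum of $\pi(T)$ in the Calkin algebra. $\operatorname{conv}$ denotes the convex hull. Put $\Pi(X):=\{(x,x^* )\in X\times X^*:\ \|x\|=\|x^*\|=1=\langle x,x^*\rangle\}$, where $\langle x,x^*\rangle$ is the value of $x^*$ at $x$. The essential numerical range $W_e(T)$ is the set of all $\lambda\in\mathbb C$ for which there exists a net $(x_\alpha,x_\alpha^* )\subset\Pi(X)$ such that $x_\alpha\to0$ weakly and $\langle Tx_\alpha,x_\alpha^*\rangle\to\lambda$. *)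

theory Defs
  imports "HOL-Analysis.Analysis" "HOL-Algebra.QuotRing" "HOL-Algebra.Module"
begin

section \<open>Complex Banach spaces\<close>

class complex_vector = real_vector +
  fixes scaleC :: "complex \<Rightarrow> 'a \<Rightarrow> 'a"  (infixr \<open>*\<^sub>C\<close> 75)
  assumes scaleC_add_right: "c *\<^sub>C (x + y) = c *\<^sub>C x + c *\<^sub>C y"
    and scaleC_add_left: "(c + d) *\<^sub>C x = c *\<^sub>C x + d *\<^sub>C x"
    and scaleC_scaleC: "c *\<^sub>C d *\<^sub>C x = (c * d) *\<^sub>C x"
    and scaleC_one: "1 *\<^sub>C x = x"
    and scaleR_scaleC: "r *\<^sub>R x = complex_of_real r *\<^sub>C x"

class complex_normed_vector = complex_vector + real_normed_vector +
  assumes norm_scaleC: "norm (c *\<^sub>C x) = cmod c * norm x"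

class complex_banach = complex_normed_vector + banach

instantiation complex :: complex_banach
begin

definition scaleC_complex :: "complex \<Rightarrow> complex \<Rightarrow> complex"
  where "scaleC_complex c z = c * z"

instance
  by standard (simp_all add: scaleC_complex_def algebra_simps norm_mult scaleR_conv_of_real)

end

definition bounded_clinear ::
    "('a::complex_normed_vector \<Rightarrow> 'b::complex_normed_vector) \<Rightarrow> bool"
  where "bounded_clinear f \<longleftrightarrow> bounded_linear f \<and> (\<forall>c x. f (c *\<^sub>C x) = c *\<^sub>C f x)"

abbreviation dual_space :: "('a::complex_normed_vector \<Rightarrow> complex) set"
  where "dual_space \<equiv> Collect bounded_clinear"


section \<open>The Calkin algebra and the essential spectrum\<close>

definition operator_algebra :: "(complex, 'a::complex_normed_vector \<Rightarrow> 'a) module"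
  where "operator_algebra =
    \<lparr>carrier = Collect bounded_clinear, monoid.mult = (\<circ>), one = id,
     zero = (\<lambda>x. 0), add = (\<lambda>S T x. S x + T x), smult = (\<lambda>c T x. c *\<^sub>C T x)\<rparr>"

definition compact_operators :: "('a::complex_normed_vector \<Rightarrow> 'a) set"
  where "compact_operators = {K. bounded_clinear K \<and> compact (closure (K ` cball 0 1))}"

text \<open>\<^const>\<open>FactRing\<close> only yields a ring; the induced scalar multiplication is added in the same
  style as \<^const>\<open>rcoset_mult\<close>.\<close>

definition quotient_algebra :: "('c, 'a, 'm) module_scheme \<Rightarrow> 'a set \<Rightarrow> ('c, 'a set) module"
  where "quotient_algebra A I =
    ring.extend (A Quot I)
      (module.fields (\<lambda>c S. \<Union>a\<in>S. I +>\<^bsub>A\<^esub> (c \<odot>\<^bsub>A\<^esub> a)))"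

definition algebra_spectrum :: "('c, 'a, 'm) module_scheme \<Rightarrow> 'a \<Rightarrow> 'c set"
  where "algebra_spectrum A a = {c. a \<ominus>\<^bsub>A\<^esub> (c \<odot>\<^bsub>A\<^esub> \<one>\<^bsub>A\<^esub>) \<notin> Units A}"

definition calkin_algebra :: "(complex, ('a::complex_normed_vector \<Rightarrow> 'a) set) module"
  where "calkin_algebra = quotient_algebra operator_algebra compact_operators"

definition calkin_proj :: "('a::complex_normed_vector \<Rightarrow> 'a) \<Rightarrow> ('a \<Rightarrow> 'a) set"
  where "calkin_proj T = compact_operators +>\<^bsub>operator_algebra\<^esub> T"

definition essential_spectrum :: "('a::complex_normed_vector \<Rightarrow> 'a) \<Rightarrow> complex set"
  where "essential_spectrum T = algebra_spectrum calkin_algebra (calkin_proj T)"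


section \<open>Nets and the essential numerical range\<close>

definition directed_by :: "'i set \<Rightarrow> ('i \<Rightarrow> 'i \<Rightarrow> bool) \<Rightarrow> bool"
  where "directed_by D leq \<longleftrightarrow> D \<noteq> {} \<and>
    (\<forall>i\<in>D. leq i i) \<and>
    (\<forall>i\<in>D. \<forall>j\<in>D. \<forall>k\<in>D. leq i j \<longrightarrow> leq j k \<longrightarrow> leq i k) \<and>
    (\<forall>i\<in>D. \<forall>j\<in>D. \<exists>k\<in>D. leq i k \<and> leq j k)"

text \<open>The filter of tails: convergence along it is convergence of the net.\<close>

definition net_filter :: "'i set \<Rightarrow> ('i \<Rightarrow> 'i \<Rightarrow> bool) \<Rightarrow> 'i filter"
  where "net_filter D leq = (INF i\<in>D. principal {j\<in>D. leq i j})"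

definition weakly_tendsto ::
    "('i \<Rightarrow> 'a::complex_normed_vector) \<Rightarrow> 'a \<Rightarrow> 'i filter \<Rightarrow> bool"
  where "weakly_tendsto x l F \<longleftrightarrow> (\<forall>g\<in>dual_space. ((\<lambda>i. g (x i)) \<longlongrightarrow> g l) F)"

definition normed_pairs :: "('a::complex_normed_vector \<times> ('a \<Rightarrow> complex)) set"
  where "normed_pairs =
    {(x, f). f \<in> dual_space \<and> norm x = 1 \<and> onorm f = 1 \<and> f x = 1}"

definition ess_num_net ::
    "('a::complex_normed_vector \<Rightarrow> 'a) \<Rightarrow> complex \<Rightarrow> 'i set \<Rightarrow> ('i \<Rightarrow> 'i \<Rightarrow> bool)
      \<Rightarrow> ('i \<Rightarrow> 'a) \<Rightarrow> ('i \<Rightarrow> 'a \<Rightarrow> complex) \<Rightarrow> bool"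
  where "ess_num_net T c D leq x f \<longleftrightarrow>
    directed_by D leq \<and> (\<forall>i\<in>D. (x i, f i) \<in> normed_pairs) \<and>
    weakly_tendsto x 0 (net_filter D leq) \<and>
    ((\<lambda>i. f i (T (x i))) \<longlongrightarrow> c) (net_filter D leq)"

text \<open>HOL cannot quantify over the type of the index set of a net, so one sufficiently large index
  type is fixed.  By \<open>ess_num_net_imp_essential_numerical_range\<close> below, nets over any other index
  type give no further points.\<close>

type_synonym 'p net_index = "'p set \<times> 'p"

definition essential_numerical_range ::
    "('a::complex_normed_vector \<Rightarrow> 'a) \<Rightarrow> complex set"
  where "essential_numerical_range T =
    {c. \<exists>(D :: ('a \<times> ('a \<Rightarrow> complex)) net_index set) leq x f. ess_num_net T c D leq x f}"

lemma eventually_net_filter: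
  assumes "directed_by D leq"
  shows "eventually P (net_filter D leq) \<longleftrightarrow> (\<exists>i\<in>D. \<forall>j\<in>D. leq i j \<longrightarrow> P j)"
proof -
  have "eventually P (net_filter D leq) \<longleftrightarrow>
      (\<exists>i\<in>D. eventually P (principal {j\<in>D. leq i j}))"
    unfolding net_filter_def
  proof (rule eventually_INF_base)
    show "D \<noteq> {}" using assms by (simp add: directed_by_def)
    fix i j assume ij: "i \<in> D" "j \<in> D"
    then obtain k where k: "k \<in> D" "leq i k" "leq j k"
      using assms unfolding directed_by_def by meson
    have "{l\<in>D. leq k l} \<subseteq> {l\<in>D. leq i l} \<inter> {l\<in>D. leq j l}"
      using assms ij k unfolding directed_by_def by blast
    with k(1) show "\<exists>k\<in>D. principal {l\<in>D. leq k l} \<le>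
        inf (principal {l\<in>D. leq i l}) (principal {l\<in>D. leq j l})"
      by auto
  qed
  then show ?thesis by (auto simp: eventually_principal)
qed

lemma ess_num_net_imp_essential_numerical_range:
  fixes D :: "'i set"
  assumes net: "ess_num_net T c D leq x f"
  shows "c \<in> essential_numerical_range T"
proof -
  define tail where "tail i = (\<lambda>j. (x j, f j)) ` {j\<in>D. leq i j}" for i
  define E where "E = {(A, p). p \<in> A \<and> (\<exists>i\<in>D. A = tail i)}"
  define ge where "ge a b \<longleftrightarrow> fst b \<subseteq> fst a"
    for a b :: "('a \<times> ('a \<Rightarrow> complex)) net_index"
  have dir: "directed_by D leq" using net by (simp add: ess_num_net_def)
  have tail_mem: "(x i, f i) \<in> tail i" if "i \<in> D" for i
    using that dir by (auto simp: tail_def directed_by_def)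
  have tail_mono: "tail j \<subseteq> tail i" if "i \<in> D" "j \<in> D" "leq i j" for i j
    using that dir unfolding tail_def directed_by_def by blast
  have dirE: "directed_by E ge"
    unfolding directed_by_def
  proof (intro conjI ballI impI)
    obtain i where "i \<in> D" using dir by (auto simp: directed_by_def)
    then show "E \<noteq> {}" using tail_mem by (auto simp: E_def)
  next
    fix a b assume "a \<in> E" "b \<in> E"
    then obtain i j where ij: "i \<in> D" "j \<in> D" "fst a = tail i" "fst b = tail j"
      by (auto simp: E_def)
    then obtain k where k: "k \<in> D" "leq i k" "leq j k"
      using dir unfolding directed_by_def by meson
    have "(tail k, (x k, f k)) \<in> E" using k tail_mem by (auto simp: E_def)
    moreover have "ge a (tail k, (x k, f k))" "ge b (tail k, (x k, f k))"
      using ij k tail_mono by (simp_all add: ge_def)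
    ultimately show "\<exists>c\<in>E. ge a c \<and> ge b c" by blast
  qed (auto simp: ge_def)
  have ev: "eventually (\<lambda>e. P (snd e)) (net_filter E ge)"
    if "eventually (\<lambda>i. P (x i, f i)) (net_filter D leq)" for P
  proof -
    obtain i where i: "i \<in> D" "\<And>j. j \<in> D \<Longrightarrow> leq i j \<Longrightarrow> P (x j, f j)"
      using \<open>eventually _ _\<close> eventually_net_filter[OF dir] by auto
    have "(tail i, (x i, f i)) \<in> E" using i tail_mem by (auto simp: E_def)
    moreover have "P (snd e)" if "e \<in> E" "ge (tail i, (x i, f i)) e" for e
    proof -
      have "snd e \<in> tail i" using that by (auto simp: E_def ge_def)
      then show ?thesis using i by (auto simp: tail_def)
    qed
    ultimately show ?thesis using eventually_net_filter[OF dirE] by blast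
  qed
  have lim: "((\<lambda>e. h (snd e)) \<longlongrightarrow> l) (net_filter E ge)"
    if "((\<lambda>i. h (x i, f i)) \<longlongrightarrow> l) (net_filter D leq)" for h :: "_ \<Rightarrow> complex" and l
    using that ev[of "\<lambda>p. h p \<in> _"] unfolding tendsto_def by blast
  have "ess_num_net T c E ge (fst \<circ> snd) (snd \<circ> snd)"
    unfolding ess_num_net_def
  proof (intro conjI ballI)
    show "directed_by E ge" by (rule dirE)
    fix e assume "e \<in> E"
    then show "((fst \<circ> snd) e, (snd \<circ> snd) e) \<in> normed_pairs"
      using net by (auto simp: E_def tail_def ess_num_net_def)
  next
    show "weakly_tendsto (fst \<circ> snd) 0 (net_filter E ge)"
      using net lim[of "\<lambda>p. _ (fst p)"]
      by (auto simp: weakly_tendsto_def ess_num_net_def)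
  next
    show "((\<lambda>e. (snd \<circ> snd) e (T ((fst \<circ> snd) e))) \<longlongrightarrow> c) (net_filter E ge)"
      using net lim[of "\<lambda>p. snd p (T (fst p))"] by (simp add: ess_num_net_def)
  qed
  then show ?thesis unfolding essential_numerical_range_def by blast
qed

end

theory Submission
  imports Defs
begin

text \<open>
  Call \<open>l\<close> an essential approximate eigenvalue of \<open>T\<close> if \<open>T - l\<close> is not bounded below on any closed
  subspace of finite codimension. The proof passes through the convex hull of the set of these
  numbers: it contains the essential spectrum, and it is contained in \<open>W\<^sub>e(T)\<close>.

  For the first inclusion, the decisive fact is a stability theorem
  (\<open>essentially_invertible_perturb\<close>): as long as an operator stays bounded below on subspaces of
  finite codimension, its invertibility modulo compact operators cannot change under small
  perturbations, in either direction. The set of essential approximate eigenvalues is compact, so a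
  point \<open>l\<close> outside its convex hull can be joined to infinity by a ray that misses the hull. Along
  this ray invertibility modulo compact operators is locally constant, hence constant, and at
  infinity it holds. So \<open>l\<close> is not in the essential spectrum.

  For the second inclusion, let \<open>c = \<Sum>l. p\<^sub>l l\<close> be a convex combination of essential approximate
  eigenvalues. Given finitely many functionals and \<open>e > 0\<close>, there are unit vectors \<open>x\<^sub>l\<close> on which
  these functionals vanish and with \<open>T x\<^sub>l - l x\<^sub>l\<close> of norm below \<open>e\<close>. Norming functionals keep the
  \<open>x\<^sub>l\<close> linearly independent in a quantitative way that does not depend on \<open>e\<close>. Zenger's lemma then
  yields a unit vector \<open>v = \<Sum>l. z\<^sub>l x\<^sub>l\<close> and a norm-one functional \<open>F\<close> with \<open>z\<^sub>l F(x\<^sub>l) = p\<^sub>l\<close>, so that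
  \<open>F(v) = 1\<close> and \<open>F(T v) \<approx> \<Sum>l. z\<^sub>l l F(x\<^sub>l) = c\<close>. The net of these pairs, indexed by the finite sets
  of functionals and the errors, is weakly null and shows \<open>c \<in> W\<^sub>e(T)\<close>.
\<close>

section \<open>Bounded complex-linear maps\<close>

lemma bounded_bilinear_scaleC:
  "bounded_bilinear (scaleC :: complex \<Rightarrow> 'a::complex_normed_vector \<Rightarrow> 'a)"
proof (rule bounded_bilinear.intro)
  show "\<exists>K. \<forall>a (b::'a). norm (a *\<^sub>C b) \<le> norm a * norm b * K"
    by (rule exI[of _ 1]) (simp add: norm_scaleC)
qed (simp_all add: scaleC_add_left scaleC_add_right scaleR_scaleC[where 'a = 'a] scaleC_scaleC
    mult.commute scaleR_conv_of_real)

interpretation scaleC: bounded_bilinear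
  "scaleC :: complex \<Rightarrow> 'a::complex_normed_vector \<Rightarrow> 'a"
  by (rule bounded_bilinear_scaleC)

lemma bounded_clinearI:
  assumes "\<And>x y. f (x + y) = f x + f y" "\<And>c x. f (c *\<^sub>C x) = c *\<^sub>C f x"
    and "\<And>x. norm (f x) \<le> K * norm x"
  shows "bounded_clinear f"
  unfolding bounded_clinear_def
  by (auto intro!: bounded_linear_intro[where K = K]
      simp: assms scaleR_scaleC mult.commute)

lemma bounded_clinear_bounded_linear: "bounded_clinear f \<Longrightarrow> bounded_linear f"
  by (simp add: bounded_clinear_def)

lemma bounded_clinear_scaleC: "bounded_clinear f \<Longrightarrow> f (c *\<^sub>C x) = c *\<^sub>C f x"
  by (simp add: bounded_clinear_def)

lemmas bounded_clinear_add = linear_add[OF bounded_linear.linear[OF bounded_clinear_bounded_linear]]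
lemmas bounded_clinear_diff = linear_diff[OF bounded_linear.linear[OF bounded_clinear_bounded_linear]]
lemmas bounded_clinear_zero = linear_0[OF bounded_linear.linear[OF bounded_clinear_bounded_linear]]
lemmas bounded_clinear_sum = linear_sum[OF bounded_linear.linear[OF bounded_clinear_bounded_linear]]

lemmas bounded_clinear_simps = bounded_clinear_scaleC bounded_clinear_add bounded_clinear_diff
  bounded_clinear_zero

lemma bounded_clinear_pos_bound:
  assumes "bounded_clinear f"
  obtains K where "K > 0" "\<And>x. norm (f x) \<le> K * norm x"
  using bounded_linear.pos_bounded[OF bounded_clinear_bounded_linear[OF assms]]
  by (metis mult.commute)

lemma bounded_clinear_plus:
  "bounded_clinear f \<Longrightarrow> bounded_clinear g \<Longrightarrow> bounded_clinear (\<lambda>x. f x + g x)"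
  by (simp add: bounded_clinear_def bounded_linear_add scaleC_add_right)

lemma bounded_clinear_minus:
  "bounded_clinear f \<Longrightarrow> bounded_clinear g \<Longrightarrow> bounded_clinear (\<lambda>x. f x - g x)"
  by (simp add: bounded_clinear_def bounded_linear_sub scaleC.diff_right)

lemma bounded_clinear_smult: "bounded_clinear f \<Longrightarrow> bounded_clinear (\<lambda>x. c *\<^sub>C f x)"
  by (simp add: bounded_clinear_def scaleC_scaleC mult.commute
      bounded_linear_compose[OF scaleC.bounded_linear_right])

lemma bounded_clinear_comp:
  "bounded_clinear f \<Longrightarrow> bounded_clinear g \<Longrightarrow> bounded_clinear (\<lambda>x. f (g x))"
  by (simp add: bounded_clinear_def bounded_linear_compose)

lemma bounded_clinear_id: "bounded_clinear (\<lambda>x. x)"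
  by (simp add: bounded_clinear_def)

lemma bounded_clinear_const_0: "bounded_clinear (\<lambda>x. 0)"
  by (simp add: bounded_clinear_def scaleC.zero_right)

lemma bounded_clinear_rank_one:
  "g \<in> dual_space \<Longrightarrow> bounded_clinear (\<lambda>x. g x *\<^sub>C e)"
  by (auto simp: bounded_clinear_def scaleC_complex_def scaleC_scaleC
      intro: bounded_linear_compose[OF scaleC.bounded_linear_left])

lemmas bounded_clinear_intros = bounded_clinear_plus bounded_clinear_minus bounded_clinear_smult
  bounded_clinear_id bounded_clinear_const_0

section \<open>The Hahn-Banach theorem\<close>

text \<open>Linear functionals dominated by the norm are encoded by their graphs: a linear subspace
  of the subgraph of the norm is automatically single valued, and Zorn's lemma applies to such
  subspaces ordered by inclusion.\<close>

lemma hahn_banach_graph: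
  fixes G :: "('a::real_normed_vector \<times> real) set"
  assumes G: "subspace G" and le: "\<And>x r. (x, r) \<in> G \<Longrightarrow> r \<le> norm x"
  obtains u where "linear u" "\<And>x. u x \<le> norm x" "\<And>x r. (x, r) \<in> G \<Longrightarrow> u x = r"
proof -
  define A where "A = {H. subspace H \<and> G \<subseteq> H \<and> (\<forall>(x, r)\<in>H. r \<le> norm x)}"
  have "\<exists>M\<in>A. \<forall>H\<in>A. M \<subseteq> H \<longrightarrow> H = M"
  proof (rule subset_Zorn_nonempty)
    show "A \<noteq> {}" using G le by (auto simp: A_def)
    fix C assume C: "C \<noteq> {}" "subset.chain A C"
    then have CA: "\<And>H. H \<in> C \<Longrightarrow> subspace H \<and> G \<subseteq> H \<and> (\<forall>(x, r)\<in>H. r \<le> norm x)"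
      by (auto simp: A_def subset_chain_def)
    have "subspace (\<Union>C)"
    proof (rule subspaceI)
      show "0 \<in> \<Union>C" using C(1) CA subspace_0 by blast
    next
      fix x y assume "x \<in> \<Union>C" "y \<in> \<Union>C"
      then obtain H K where HK: "H \<in> C" "K \<in> C" "x \<in> H" "y \<in> K" by blast
      then have "H \<subseteq> K \<or> K \<subseteq> H" using C(2) by (auto simp: subset_chain_def)
      then show "x + y \<in> \<Union>C" using HK CA subspace_add by blast
    next
      fix c x assume "x \<in> \<Union>C"
      then show "c *\<^sub>R x \<in> \<Union>C" using CA subspace_scale by blast
    qed
    then show "\<Union>C \<in> A" using C(1) CA unfolding A_def by blast
  qed
  then obtain M where "M \<in> A" and max: "\<And>H. H \<in> A \<Longrightarrow> M \<subseteq> H \<Longrightarrow> H = M" by blast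
  then have M: "subspace M" "G \<subseteq> M" "\<And>x r. (x, r) \<in> M \<Longrightarrow> r \<le> norm x"
    by (auto simp: A_def)
  have M_add: "(x, r) \<in> M \<Longrightarrow> (y, s) \<in> M \<Longrightarrow> (x + y, r + s) \<in> M" for x y r s
    using subspace_add[OF M(1)] by fastforce
  have M_diff: "(x, r) \<in> M \<Longrightarrow> (y, s) \<in> M \<Longrightarrow> (x - y, r - s) \<in> M" for x y r s
    using subspace_diff[OF M(1)] by fastforce
  have M_scale: "(x, r) \<in> M \<Longrightarrow> (c *\<^sub>R x, c * r) \<in> M" for x r c
    using subspace_scale[OF M(1), of "(x, r)" c] by simp
  have single: "r = s" if "(x, r) \<in> M" "(x, s) \<in> M" for x r s
    using M(3)[OF M_diff[OF that]] M(3)[OF M_diff[OF that(2,1)]] by simp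
  have total: "\<exists>r. (v, r) \<in> M" for v
  proof -
    \<comment> \<open>\<open>\<xi>\<close> is a value at \<open>v\<close> compatible with the bound on both sides.\<close>
    define \<xi> where "\<xi> = (SUP (y, r)\<in>M. r - norm (y - v))"
    have bound: "r - norm (y - v) \<le> norm (z + v) - s" if "(y, r) \<in> M" "(z, s) \<in> M" for y z r s
      using M(3)[OF M_add[OF that]] norm_triangle_ineq[of "y - v" "z + v"] by simp
    have M0: "(0, 0) \<in> M" using subspace_0[OF M(1)] by (simp add: zero_prod_def)
    have lower: "r - norm (y - v) \<le> \<xi>" if "(y, r) \<in> M" for y r
      unfolding \<xi>_def using that bound[OF _ M0]
      by (intro cSUP_upper2[where x = "(y, r)"]) (auto intro!: bdd_aboveI[where M = "norm (0 + v) - 0"])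
    have upper: "\<xi> \<le> norm (z + v) - s" if "(z, s) \<in> M" for z s
      unfolding \<xi>_def using M0 bound[OF _ that] by (intro cSUP_least) auto
    define H where "H = {(y + t *\<^sub>R v, r + t * \<xi>) | y r t. (y, r) \<in> M}"
    have HI: "(y + t *\<^sub>R v, r + t * \<xi>) \<in> H" if "(y, r) \<in> M" for y r t
      using that by (auto simp: H_def)
    have "subspace H"
    proof (rule subspaceI)
      show "0 \<in> H" using HI[OF M0, of 0] by (simp add: zero_prod_def)
    next
      fix p q assume "p \<in> H" "q \<in> H"
      then obtain y r t z s t' where "(y, r) \<in> M" "(z, s) \<in> M"
        "p = (y + t *\<^sub>R v, r + t * \<xi>)" "q = (z + t' *\<^sub>R v, s + t' * \<xi>)"
        unfolding H_def by blast
      then show "p + q \<in> H" using HI[OF M_add, of y r z s "t + t'"] by (simp add: algebra_simps)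
    next
      fix c p assume "p \<in> H"
      then obtain y r t where "(y, r) \<in> M" "p = (y + t *\<^sub>R v, r + t * \<xi>)" by (auto simp: H_def)
      then show "c *\<^sub>R p \<in> H" using HI[OF M_scale, of y r c "c * t"] by (simp add: algebra_simps)
    qed
    moreover have "M \<subseteq> H" using HI[where t = 0] by auto
    moreover have "r + t * \<xi> \<le> norm (y + t *\<^sub>R v)" if yr: "(y, r) \<in> M" for y r t
    proof -
      consider "t = 0" | "t > 0" | "t < 0" by linarith
      then show ?thesis
      proof cases
        case 1 then show ?thesis using M(3)[OF yr] by simp
      next
        case 2
        have "t * \<xi> \<le> t * (norm ((1/t) *\<^sub>R y + v) - 1/t * r)"
          using 2 upper[OF M_scale[OF yr, of "1/t"]] by (intro mult_left_mono) auto
        also have "\<dots> = norm (t *\<^sub>R ((1/t) *\<^sub>R y + v)) - r"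
          using 2 by (simp add: right_diff_distrib)
        also have "t *\<^sub>R ((1/t) *\<^sub>R y + v) = y + t *\<^sub>R v" using 2 by (simp add: algebra_simps)
        finally show ?thesis by simp
      next
        case 3
        define w where "w = (1/-t) *\<^sub>R y - v"
        have "r - norm (y + t *\<^sub>R v) = (-t) * ((1/-t) * r - norm w)"
        proof -
          have "norm (y + t *\<^sub>R v) = norm ((-t) *\<^sub>R w)"
            using 3 by (simp add: w_def algebra_simps)
          also have "\<dots> = (-t) * norm w" using 3 by simp
          finally show ?thesis using 3 by (simp add: right_diff_distrib)
        qed
        also have "\<dots> \<le> (-t) * \<xi>"
          using 3 lower[OF M_scale[OF yr, of "1/-t"]] unfolding w_def
          by (intro mult_left_mono) auto
        finally show ?thesis by simp
      qed
    qed
    then have "\<forall>(x, r)\<in>H. r \<le> norm x" by (auto simp: H_def)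
    ultimately have "H = M" using M(2) by (intro max) (auto simp: A_def)
    then show ?thesis using HI[OF M0, of 1] by auto
  qed
  define u where "u x = (THE r. (x, r) \<in> M)" for x
  have u: "u x = r" if "(x, r) \<in> M" for x r
    unfolding u_def using that single by blast
  have uM: "(x, u x) \<in> M" for x using total[of x] u by auto
  show thesis
  proof
    show "linear u"
      using u[OF M_add[OF uM uM]] u[OF M_scale[OF uM]] by (intro linearI) auto
    show "u x \<le> norm x" for x using M(3)[OF uM] .
    show "u x = r" if "(x, r) \<in> G" for x r using that M(2) u by blast
  qed
qed

text \<open>The real part of a complex-linear functional determines it by \<open>F z = u z - \<i> u (\<i> z)\<close>, and
  a bound on the real part over all rotations of \<open>z\<close> is a bound on the modulus. Prescribing the
  values of \<open>F\<close> on a family rather than on its span avoids choosing a basis.\<close>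

lemma hahn_banach_interpolation:
  fixes x :: "'i \<Rightarrow> 'a::complex_normed_vector" and b :: "'i \<Rightarrow> complex"
  assumes I: "finite I" and le: "\<And>a. Re (\<Sum>i\<in>I. a i * b i) \<le> norm (\<Sum>i\<in>I. a i *\<^sub>C x i)"
  obtains F where "F \<in> dual_space" "\<And>z. cmod (F z) \<le> norm z" "\<And>i. i \<in> I \<Longrightarrow> F (x i) = b i"
proof -
  define G where "G = range (\<lambda>a. (\<Sum>i\<in>I. a i *\<^sub>C x i, Re (\<Sum>i\<in>I. a i * b i)))"
  have GI: "(\<Sum>i\<in>I. a i *\<^sub>C x i, Re (\<Sum>i\<in>I. a i * b i)) \<in> G" for a by (auto simp: G_def)
  have "subspace G"
  proof (rule subspaceI)
    show "0 \<in> G" using GI[of "\<lambda>_. 0"] by (simp add: zero_prod_def scaleC.zero_left)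
  next
    fix p q assume "p \<in> G" "q \<in> G"
    then obtain a a' where "p = (\<Sum>i\<in>I. a i *\<^sub>C x i, Re (\<Sum>i\<in>I. a i * b i))"
      "q = (\<Sum>i\<in>I. a' i *\<^sub>C x i, Re (\<Sum>i\<in>I. a' i * b i))" by (auto simp: G_def)
    then show "p + q \<in> G" using GI[of "\<lambda>i. a i + a' i"]
      by (simp add: scaleC_add_left ring_distribs sum.distrib)
  next
    fix c p assume "p \<in> G"
    then obtain a where "p = (\<Sum>i\<in>I. a i *\<^sub>C x i, Re (\<Sum>i\<in>I. a i * b i))" by (auto simp: G_def)
    then show "c *\<^sub>R p \<in> G" using GI[of "\<lambda>i. c *\<^sub>R a i"]
      by (simp add: scaleC.scaleR_left scaleR_right.sum sum_distrib_left ring_distribs mult.assoc)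
  qed
  moreover have "r \<le> norm z" if "(z, r) \<in> G" for z r using that le by (auto simp: G_def)
  ultimately obtain u where u: "linear u" "\<And>z. u z \<le> norm z" "\<And>z r. (z, r) \<in> G \<Longrightarrow> u z = r"
    using hahn_banach_graph by blast
  define F where "F z = Complex (u z) (- u (\<i> *\<^sub>C z))" for z
  have iC: "Complex r s *\<^sub>C z = r *\<^sub>R z + s *\<^sub>R (\<i> *\<^sub>C z)" for r s and z :: 'a
    by (simp add: Complex_eq scaleC_add_left scaleR_scaleC scaleC_scaleC mult.commute)
  have F_add: "F (z + w) = F z + F w" for z w
    by (simp add: F_def complex_eq_iff linear_add[OF u(1)] scaleC_add_right)
  have F_scale: "F (c *\<^sub>C z) = c * F z" for c z
  proof (cases c)
    case (Complex r s)
    have "\<i> *\<^sub>C c *\<^sub>C z = r *\<^sub>R (\<i> *\<^sub>C z) - s *\<^sub>R z"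
    proof -
      have "\<i> * c = Complex (- s) r" using Complex by (simp add: complex_eq_iff)
      then show ?thesis by (simp add: scaleC_scaleC iC)
    qed
    then show ?thesis unfolding F_def
      by (simp add: Complex iC complex_eq_iff linear_add[OF u(1)] linear_diff[OF u(1)]
          linear_scale[OF u(1)])
  qed
  have F_le: "cmod (F z) \<le> norm z" for z
  proof (cases "F z = 0")
    case False
    define c where "c = cnj (sgn (F z))"
    have "cmod (F z) = Re (c * F z)"
      using False by (simp add: c_def sgn_eq divide_simps) (simp add: cmod_power2 flip: power2_eq_square)
    also have "\<dots> = u (c *\<^sub>C z)" by (simp flip: F_scale) (simp add: F_def)
    also have "\<dots> \<le> norm (c *\<^sub>C z)" by (rule u(2))
    also have "\<dots> = norm z" using False by (simp add: norm_scaleC c_def norm_sgn)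
    finally show ?thesis .
  qed simp
  show thesis
  proof
    show "F \<in> dual_space"
      using F_le by (auto intro!: bounded_clinearI[where K = 1] simp: F_add F_scale scaleC_complex_def)
    show "cmod (F z) \<le> norm z" for z by (rule F_le)
    fix i assume i: "i \<in> I"
    have *: "u (c *\<^sub>C x i) = Re (c * b i)" for c
    proof -
      have 1: "(\<Sum>j\<in>I. (if j = i then c else 0) *\<^sub>C x j) = c *\<^sub>C x i"
        using I i by (subst sum.remove[of _ i]) (auto simp: scaleC.zero_left)
      have 2: "(\<Sum>j\<in>I. (if j = i then c else 0) * b j) = c * b i"
        using I i by (subst sum.remove[of _ i]) auto
      show ?thesis using u(3)[OF GI[of "\<lambda>j. if j = i then c else 0"]] unfolding 1 2 .
    qed
    show "F (x i) = b i"
      using *[of 1] *[of \<i>] by (simp add: F_def complex_eq_iff scaleC_one)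
  qed
qed

lemma norming_functional:
  fixes v :: "'a::complex_normed_vector"
  obtains g where "g \<in> dual_space" "\<And>z. cmod (g z) \<le> norm z" "g v = norm v"
proof -
  have "Re (\<Sum>i\<in>{()}. a i * complex_of_real (norm v)) \<le> norm (\<Sum>i\<in>{()}. a i *\<^sub>C v)" for a
    using mult_right_mono[OF complex_Re_le_cmod norm_ge_zero] by (simp add: norm_scaleC)
  from hahn_banach_interpolation[OF _ this] obtain F where
    "F \<in> dual_space" "\<And>z. cmod (F z) \<le> norm z" "\<And>i. i \<in> {()} \<Longrightarrow> F v = norm v"
    by (metis finite.intros)
  then show thesis using that[of F] by simp
qed

section \<open>Compact operators and invertibility in the Calkin algebra\<close>

lemma compact_operators_bounded_clinear: "K \<in> compact_operators \<Longrightarrow> bounded_clinear K"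
  by (simp add: compact_operators_def)

lemma compact_operatorsI:
  assumes "bounded_clinear K" "compact C" "\<And>x. norm x \<le> 1 \<Longrightarrow> K x \<in> C"
  shows "K \<in> compact_operators"
proof -
  have "K ` cball 0 1 \<subseteq> C" using assms(3) by auto
  then have "closure (K ` cball 0 1) \<subseteq> C"
    using compact_imp_closed[OF assms(2)] closure_minimal by blast
  then show ?thesis
    unfolding compact_operators_def using assms(1,2)
    by (metis (mono_tags, lifting) closed_closure compact_Int_closed inf.absorb_iff2 mem_Collect_eq)
qed

lemma compact_operators_image:
  assumes "K \<in> compact_operators"
  obtains C where "compact C" "\<And>x. norm x \<le> 1 \<Longrightarrow> K x \<in> C"
proof
  show "compact (closure (K ` cball 0 1))" using assms by (simp add: compact_operators_def)
  show "K x \<in> closure (K ` cball 0 1)" if "norm x \<le> 1" for x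
    by (rule subsetD[OF closure_subset]) (use that in auto)
qed

lemma compact_operators_plus:
  assumes "K \<in> compact_operators" "L \<in> compact_operators"
  shows "(\<lambda>x. K x + L x) \<in> compact_operators"
proof -
  obtain C where C: "compact C" "\<And>x. norm x \<le> 1 \<Longrightarrow> K x \<in> C"
    using compact_operators_image[OF assms(1)] by blast
  obtain D where D: "compact D" "\<And>x. norm x \<le> 1 \<Longrightarrow> L x \<in> D"
    using compact_operators_image[OF assms(2)] by blast
  show ?thesis
  proof (rule compact_operatorsI[OF _ compact_sums[OF C(1) D(1)]])
    show "bounded_clinear (\<lambda>x. K x + L x)"
      using assms by (intro bounded_clinear_plus compact_operators_bounded_clinear)
  qed (use C D in blast)
qed

lemma compact_operators_comp_left:
  assumes "K \<in> compact_operators" "bounded_clinear B"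
  shows "(\<lambda>x. B (K x)) \<in> compact_operators"
proof -
  obtain C where C: "compact C" "\<And>x. norm x \<le> 1 \<Longrightarrow> K x \<in> C"
    using compact_operators_image[OF assms(1)] by blast
  have "compact (B ` C)"
    using C(1) assms(2) bounded_clinear_bounded_linear linear_continuous_on
      compact_continuous_image by blast
  then show ?thesis
    using compact_operatorsI[of "\<lambda>x. B (K x)" "B ` C"] C(2) assms(2)
      bounded_clinear_comp compact_operators_bounded_clinear[OF assms(1)] by blast
qed

lemma compact_operators_smult:
  assumes "K \<in> compact_operators"
  shows "(\<lambda>x. c *\<^sub>C K x) \<in> compact_operators"
  using compact_operators_comp_left[OF assms bounded_clinear_smult[OF bounded_clinear_id]] .

lemma compact_operators_comp_right:
  assumes "K \<in> compact_operators" "bounded_clinear B"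
  shows "(\<lambda>x. K (B x)) \<in> compact_operators"
proof -
  obtain C where C: "compact C" "\<And>x. norm x \<le> 1 \<Longrightarrow> K x \<in> C"
    using compact_operators_image[OF assms(1)] by blast
  obtain M where M: "M > 0" "\<And>x. norm (B x) \<le> M * norm x"
    using bounded_clinear_pos_bound[OF assms(2)] by blast
  have K: "bounded_clinear K" using assms(1) by (rule compact_operators_bounded_clinear)
  show ?thesis
  proof (rule compact_operatorsI)
    show "compact ((\<lambda>y. M *\<^sub>R y) ` C)" using C(1) by (rule compact_scaling)
    fix x :: 'a assume x: "norm x \<le> 1"
    have "norm (B x) \<le> M" using M(2)[of x] mult_left_mono[OF x, of M] M(1) by linarith
    then have "norm ((1/M) *\<^sub>R B x) \<le> 1" using M(1) by (simp add: divide_simps)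
    from C(2)[OF this] have "M *\<^sub>R K ((1/M) *\<^sub>R B x) \<in> (\<lambda>y. M *\<^sub>R y) ` C" by blast
    then show "K (B x) \<in> (\<lambda>y. M *\<^sub>R y) ` C"
      using M(1) by (simp add: linear_scale[OF bounded_linear.linear[OF bounded_clinear_bounded_linear[OF K]]])
  qed (rule bounded_clinear_comp[OF K assms(2)])
qed

lemma compact_operators_zero: "(\<lambda>x. 0) \<in> compact_operators"
  by (rule compact_operatorsI[where C = "{0}"]) (auto simp: bounded_clinear_const_0)

lemma compact_operators_minus:
  assumes "K \<in> compact_operators" "L \<in> compact_operators"
  shows "(\<lambda>x. K x - L x) \<in> compact_operators"
  using compact_operators_plus[OF assms(1) compact_operators_smult[OF assms(2), of "-1"]]
  by (simp add: scaleC.minus_left scaleC_one)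

lemma compact_operators_rank_one:
  fixes e :: "'a::complex_normed_vector"
  assumes g: "g \<in> dual_space"
  shows "(\<lambda>x. g x *\<^sub>C e) \<in> compact_operators"
proof -
  obtain M where M: "M > 0" "\<And>x. norm (g x) \<le> M * norm x"
    using bounded_clinear_pos_bound g by (metis mem_Collect_eq)
  show ?thesis
  proof (rule compact_operatorsI)
    show "compact ((\<lambda>c. c *\<^sub>C e) ` cball 0 M)"
      by (intro compact_continuous_image linear_continuous_on scaleC.bounded_linear_left) simp
    fix x :: 'a assume "norm x \<le> 1"
    then have "norm (g x) \<le> M" using M(2)[of x] mult_left_mono[of "norm x" 1 M] M(1) by linarith
    then show "g x *\<^sub>C e \<in> (\<lambda>c. c *\<^sub>C e) ` cball 0 M" by simp
  qed (rule bounded_clinear_rank_one[OF g])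
qed

lemma ring_operator_algebra:
  "ring (operator_algebra :: (complex, 'a::complex_normed_vector \<Rightarrow> 'a) module)"
proof (rule ringI)
  show "abelian_group (operator_algebra :: (complex, 'a \<Rightarrow> 'a) module)"
  proof (rule abelian_groupI)
    fix S :: "'a \<Rightarrow> 'a" assume S: "S \<in> carrier operator_algebra"
    show "\<exists>y\<in>carrier operator_algebra. y \<oplus>\<^bsub>operator_algebra\<^esub> S = \<zero>\<^bsub>operator_algebra\<^esub>"
      by (rule bexI[of _ "\<lambda>x. 0 - S x"])
         (use S in \<open>auto simp: operator_algebra_def intro!: bounded_clinear_minus bounded_clinear_const_0
            simp del: diff_0\<close>)
  qed (auto simp: operator_algebra_def bounded_clinear_plus bounded_clinear_const_0 algebra_simps)
  show "monoid (operator_algebra :: (complex, 'a \<Rightarrow> 'a) module)"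
    by (rule monoidI) (auto simp: operator_algebra_def comp_def id_def bounded_clinear_id bounded_clinear_comp)
qed (auto simp: operator_algebra_def fun_eq_iff bounded_clinear_add)

lemma ideal_compact_operators:
  "ideal (compact_operators :: ('a::complex_normed_vector \<Rightarrow> 'a) set) operator_algebra"
proof (rule idealI[OF ring_operator_algebra])
  interpret ring "operator_algebra :: (complex, 'a \<Rightarrow> 'a) module" by (rule ring_operator_algebra)
  show "subgroup (compact_operators :: ('a \<Rightarrow> 'a) set) (add_monoid operator_algebra)"
  proof (rule subgroup.intro)
    fix K :: "'a \<Rightarrow> 'a" assume K: "K \<in> compact_operators"
    have "\<ominus>\<^bsub>operator_algebra\<^esub> K = (\<lambda>x. 0 - K x)"
    proof (rule minus_equality)
      show "(\<lambda>x. 0 - K x) \<oplus>\<^bsub>operator_algebra\<^esub> K = \<zero>\<^bsub>operator_algebra\<^esub>"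
        by (simp add: operator_algebra_def)
      show "K \<in> carrier operator_algebra"
        using K by (simp add: operator_algebra_def compact_operators_def)
      show "(\<lambda>x. 0 - K x) \<in> carrier operator_algebra"
        using compact_operators_minus[OF compact_operators_zero K]
        by (simp add: operator_algebra_def compact_operators_def)
    qed
    then show "inv\<^bsub>add_monoid operator_algebra\<^esub> K \<in> compact_operators"
      using compact_operators_minus[OF compact_operators_zero K] by (simp add: a_inv_def)
  qed (auto simp: operator_algebra_def compact_operators_zero compact_operators_plus
        dest: compact_operators_bounded_clinear)
qed (auto simp: operator_algebra_def comp_def compact_operators_comp_left compact_operators_comp_right)

text \<open>By Atkinson's theorem, these are the Fredholm operators.\<close>

definition essentially_invertible :: "('a::complex_normed_vector \<Rightarrow> 'a) \<Rightarrow> bool"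
  where "essentially_invertible S \<longleftrightarrow> bounded_clinear S \<and>
    (\<exists>R. bounded_clinear R \<and> (\<lambda>x. R (S x) - x) \<in> compact_operators \<and>
      (\<lambda>x. S (R x) - x) \<in> compact_operators)"

text \<open>An inverse modulo compact operators is an inverse of the coset in the quotient ring. The Calkin
  algebra differs from this ring only by its scalar multiplication, which the spectrum applies to the
  unit alone.\<close>

lemma essential_spectrum_not_essentially_invertible:
  fixes T :: "'a::complex_normed_vector \<Rightarrow> 'a"
  assumes T: "bounded_clinear T" and c: "c \<in> essential_spectrum T"
  shows "\<not> essentially_invertible (\<lambda>x. T x - c *\<^sub>C x)"
proof
  let ?A = "operator_algebra :: (complex, 'a \<Rightarrow> 'a) module"
  let ?K = "compact_operators :: ('a \<Rightarrow> 'a) set"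
  let ?C = "calkin_algebra :: (complex, ('a \<Rightarrow> 'a) set) module"
  let ?S = "\<lambda>x. T x - c *\<^sub>C x"
  interpret A: ring ?A by (rule ring_operator_algebra)
  interpret I: ideal ?K ?A by (rule ideal_compact_operators)
  interpret Q: ring "?A Quot ?K" by (rule I.quotient_is_ring)
  note hom = ring_hom_memE[OF I.rcos_ring_hom]
  interpret h: ring_hom_ring ?A "?A Quot ?K" "(+>\<^bsub>?A\<^esub>) ?K" by (rule I.rcos_ring_hom_ring)
  have carrier: "S \<in> carrier ?A \<longleftrightarrow> bounded_clinear S" for S by (simp add: operator_algebra_def)
  have neg: "\<ominus>\<^bsub>?A\<^esub> S = (\<lambda>x. - S x)" if "bounded_clinear S" for S
  proof (rule A.minus_equality)
    show "(\<lambda>x. - S x) \<oplus>\<^bsub>?A\<^esub> S = \<zero>\<^bsub>?A\<^esub>" by (simp add: operator_algebra_def)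
    show "(\<lambda>x. - S x) \<in> carrier ?A"
      using bounded_clinear_minus[OF bounded_clinear_const_0 that] by (simp add: carrier)
  qed (simp add: carrier that)
  have coset_eq: "?K +>\<^bsub>?A\<^esub> S = ?K +>\<^bsub>?A\<^esub> S'"
    if "bounded_clinear S" "bounded_clinear S'" "(\<lambda>x. S x - S' x) \<in> ?K" for S S'
  proof (rule sym, rule A.a_repr_independence[OF _ _ I.a_subgroup])
    show "S \<in> ?K +>\<^bsub>?A\<^esub> S'"
      using that(3) by (force simp: a_r_coset_def r_coset_def operator_algebra_def)
  qed (simp add: carrier that)
  have cI: "bounded_clinear (\<lambda>x. c *\<^sub>C x)" by (intro bounded_clinear_intros)
  have T': "T \<in> carrier ?A" and cI': "(\<lambda>x. c *\<^sub>C x) \<in> carrier ?A"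
    using T cI by (simp_all add: carrier)
  have S: "bounded_clinear ?S" using T cI by (rule bounded_clinear_minus)
  have smult_eq: "c \<odot>\<^bsub>?C\<^esub> X = (\<Union>a\<in>X. ?K +>\<^bsub>?A\<^esub> (\<lambda>x. c *\<^sub>C a x))" for X
  proof -
    have "c \<odot>\<^bsub>?A\<^esub> a = (\<lambda>x. c *\<^sub>C a x)" for a by (simp add: operator_algebra_def)
    then show ?thesis
      by (simp add: calkin_algebra_def quotient_algebra_def ring.extend_def module.fields_def)
  qed
  have one_eq: "\<one>\<^bsub>?C\<^esub> = ?K +>\<^bsub>?A\<^esub> id"
  proof -
    have "\<one>\<^bsub>?C\<^esub> = \<one>\<^bsub>?A Quot ?K\<^esub>"
      by (simp add: calkin_algebra_def quotient_algebra_def ring.extend_def module.fields_def)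
    also have "\<dots> = ?K +>\<^bsub>?A\<^esub> \<one>\<^bsub>?A\<^esub>" by simp
    also have "\<one>\<^bsub>?A\<^esub> = id" by (simp add: operator_algebra_def)
    finally show ?thesis .
  qed
  \<comment> \<open>Every representative of the unit gives the same coset, so the union is a single coset.\<close>
  have smult_one: "c \<odot>\<^bsub>?C\<^esub> \<one>\<^bsub>?C\<^esub> = ?K +>\<^bsub>?A\<^esub> (\<lambda>x. c *\<^sub>C x)"
  proof -
    have "(\<Union>a\<in>?K +>\<^bsub>?A\<^esub> id. ?K +>\<^bsub>?A\<^esub> (\<lambda>x. c *\<^sub>C a x)) = ?K +>\<^bsub>?A\<^esub> (\<lambda>x. c *\<^sub>C x)"
    proof -
      have "?K +>\<^bsub>?A\<^esub> (\<lambda>x. c *\<^sub>C a x) = ?K +>\<^bsub>?A\<^esub> (\<lambda>x. c *\<^sub>C x)" if a: "a \<in> ?K +>\<^bsub>?A\<^esub> id" for a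
      proof -
        obtain K where K: "K \<in> ?K" "a = (\<lambda>x. K x + x)"
          using a by (auto simp: a_r_coset_def r_coset_def operator_algebra_def)
        show ?thesis
        proof (rule coset_eq)
          show "bounded_clinear (\<lambda>x. c *\<^sub>C a x)"
            unfolding K(2) by (intro bounded_clinear_intros compact_operators_bounded_clinear K(1))
          show "(\<lambda>x. c *\<^sub>C a x - c *\<^sub>C x) \<in> ?K"
            using compact_operators_smult[OF K(1)] by (simp add: K(2) scaleC_add_right)
        qed (rule cI)
      qed
      moreover have "id \<in> ?K +>\<^bsub>?A\<^esub> id"
        using compact_operators_zero by (force simp: a_r_coset_def r_coset_def operator_algebra_def)
      ultimately show ?thesis by blast
    qed
    then show ?thesis
      by (simp add: smult_eq one_eq)
  qed
  have C_simps: "carrier ?C = carrier (?A Quot ?K)" "x \<otimes>\<^bsub>?C\<^esub> y = x \<otimes>\<^bsub>?A Quot ?K\<^esub> y"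
      "\<one>\<^bsub>?C\<^esub> = \<one>\<^bsub>?A Quot ?K\<^esub>" "x \<oplus>\<^bsub>?C\<^esub> y = x \<oplus>\<^bsub>?A Quot ?K\<^esub> y" "\<zero>\<^bsub>?C\<^esub> = \<zero>\<^bsub>?A Quot ?K\<^esub>" for x y
    by (simp_all add: calkin_algebra_def quotient_algebra_def ring.extend_def module.fields_def)
  have "x \<ominus>\<^bsub>?C\<^esub> y = x \<ominus>\<^bsub>?A Quot ?K\<^esub> y" for x y
    by (simp add: a_minus_def a_inv_def m_inv_def C_simps)
  then have "calkin_proj T \<ominus>\<^bsub>?C\<^esub> (c \<odot>\<^bsub>?C\<^esub> \<one>\<^bsub>?C\<^esub>) =
      (?K +>\<^bsub>?A\<^esub> T) \<ominus>\<^bsub>?A Quot ?K\<^esub> (?K +>\<^bsub>?A\<^esub> (\<lambda>x. c *\<^sub>C x))"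
    by (simp add: smult_one calkin_proj_def)
  also have "\<dots> = ?K +>\<^bsub>?A\<^esub> (T \<ominus>\<^bsub>?A\<^esub> (\<lambda>x. c *\<^sub>C x))"
    unfolding a_minus_def
    using h.hom_add[OF T' A.a_inv_closed[OF cI']] h.hom_a_inv[OF cI'] by metis
  also have "T \<ominus>\<^bsub>?A\<^esub> (\<lambda>x. c *\<^sub>C x) = ?S"
    by (simp add: a_minus_def neg[OF cI]) (simp add: operator_algebra_def)
  finally have diff: "calkin_proj T \<ominus>\<^bsub>?C\<^esub> (c \<odot>\<^bsub>?C\<^esub> \<one>\<^bsub>?C\<^esub>) = ?K +>\<^bsub>?A\<^esub> ?S" .
  assume "essentially_invertible ?S"
  then obtain R where R: "bounded_clinear R" "(\<lambda>x. R (?S x) - x) \<in> ?K" "(\<lambda>x. ?S (R x) - x) \<in> ?K"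
    by (auto simp: essentially_invertible_def)
  have one: "\<one>\<^bsub>?A\<^esub> = (\<lambda>x. x)" by (simp add: operator_algebra_def id_def)
  have "(?K +>\<^bsub>?A\<^esub> R) \<otimes>\<^bsub>?A Quot ?K\<^esub> (?K +>\<^bsub>?A\<^esub> ?S) = \<one>\<^bsub>?A Quot ?K\<^esub>"
  proof -
    have "(?K +>\<^bsub>?A\<^esub> R) \<otimes>\<^bsub>?A Quot ?K\<^esub> (?K +>\<^bsub>?A\<^esub> ?S) = ?K +>\<^bsub>?A\<^esub> (R \<otimes>\<^bsub>?A\<^esub> ?S)"
      using R(1) S by (simp add: carrier)
    also have "R \<otimes>\<^bsub>?A\<^esub> ?S = (\<lambda>x. R (?S x))" by (simp add: operator_algebra_def comp_def)
    also have "?K +>\<^bsub>?A\<^esub> (\<lambda>x. R (?S x)) = ?K +>\<^bsub>?A\<^esub> \<one>\<^bsub>?A\<^esub>"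
      unfolding one by (rule coset_eq[OF bounded_clinear_comp[OF R(1) S] bounded_clinear_id R(2)])
    finally show ?thesis by simp
  qed
  moreover have "(?K +>\<^bsub>?A\<^esub> ?S) \<otimes>\<^bsub>?A Quot ?K\<^esub> (?K +>\<^bsub>?A\<^esub> R) = \<one>\<^bsub>?A Quot ?K\<^esub>"
  proof -
    have "(?K +>\<^bsub>?A\<^esub> ?S) \<otimes>\<^bsub>?A Quot ?K\<^esub> (?K +>\<^bsub>?A\<^esub> R) = ?K +>\<^bsub>?A\<^esub> (?S \<otimes>\<^bsub>?A\<^esub> R)"
      using R(1) S by (simp add: carrier)
    also have "?S \<otimes>\<^bsub>?A\<^esub> R = (\<lambda>x. ?S (R x))" by (simp add: operator_algebra_def comp_def)
    also have "?K +>\<^bsub>?A\<^esub> (\<lambda>x. ?S (R x)) = ?K +>\<^bsub>?A\<^esub> \<one>\<^bsub>?A\<^esub>"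
      unfolding one by (rule coset_eq[OF bounded_clinear_comp[OF S R(1)] bounded_clinear_id R(3)])
    finally show ?thesis by simp
  qed
  ultimately have "?K +>\<^bsub>?A\<^esub> ?S \<in> Units ?C"
    using h.hom_closed[of R] h.hom_closed[of ?S] R(1) S
    by (auto simp: Units_def C_simps carrier)
  then show False
    using c by (simp add: essential_spectrum_def algebra_spectrum_def diff)
qed

section \<open>Closed subspaces of finite codimension\<close>

definition complex_subspace :: "'a::complex_normed_vector set \<Rightarrow> bool"
  where "complex_subspace Y \<longleftrightarrow> 0 \<in> Y \<and> (\<forall>x\<in>Y. \<forall>y\<in>Y. x + y \<in> Y) \<and> (\<forall>c. \<forall>x\<in>Y. c *\<^sub>C x \<in> Y)"

lemma complex_subspace_0: "complex_subspace Y \<Longrightarrow> 0 \<in> Y"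
  and complex_subspace_add: "complex_subspace Y \<Longrightarrow> x \<in> Y \<Longrightarrow> y \<in> Y \<Longrightarrow> x + y \<in> Y"
  and complex_subspace_scaleC: "complex_subspace Y \<Longrightarrow> x \<in> Y \<Longrightarrow> c *\<^sub>C x \<in> Y"
  by (auto simp: complex_subspace_def)

lemma complex_subspace_scaleR: "complex_subspace Y \<Longrightarrow> x \<in> Y \<Longrightarrow> r *\<^sub>R x \<in> Y"
  by (simp add: scaleR_scaleC complex_subspace_scaleC)

lemma complex_subspace_diff: "complex_subspace Y \<Longrightarrow> x \<in> Y \<Longrightarrow> y \<in> Y \<Longrightarrow> x - y \<in> Y"
  using complex_subspace_add[of Y x "(-1) *\<^sub>C y"] complex_subspace_scaleC[of Y y "-1"]
  by (simp add: scaleC.minus_left scaleC_one)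

lemma complex_subspace_imp_subspace: "complex_subspace Y \<Longrightarrow> subspace Y"
  by (auto intro!: subspaceI complex_subspace_0 complex_subspace_add complex_subspace_scaleR)

text \<open>Halving the distance to \<open>Z\<close> over and over shows that \<open>Z\<close> is dense.\<close>

lemma complex_subspace_eq_UNIV:
  fixes Z :: "'a::complex_normed_vector set"
  assumes Z: "complex_subspace Z" "closed Z"
    and half: "\<And>x. norm x \<le> 1 \<Longrightarrow> \<exists>z\<in>Z. norm (x - z) \<le> 1/2"
  shows "Z = UNIV"
proof -
  have step: "\<exists>z\<in>Z. norm (x - z) \<le> norm x / 2" for x
  proof (cases "x = 0")
    case False
    then obtain z where z: "z \<in> Z" "norm (sgn x - z) \<le> 1/2" using half[of "sgn x"] by (auto simp: norm_sgn)
    have "x - norm x *\<^sub>R z = norm x *\<^sub>R (sgn x - z)"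
      using False by (simp add: sgn_div_norm algebra_simps)
    then have "norm (x - norm x *\<^sub>R z) = norm x * norm (sgn x - z)" by simp
    also have "\<dots> \<le> norm x * (1/2)" using z(2) by (intro mult_left_mono) auto
    finally show ?thesis using complex_subspace_scaleR[OF Z(1) z(1)] by auto
  qed (use Z in \<open>auto intro!: bexI[of _ 0] complex_subspace_0\<close>)
  have iter: "\<exists>z\<in>Z. norm (x - z) \<le> norm x / 2 ^ n" for x n
  proof (induction n)
    case 0
    then show ?case using complex_subspace_0[OF Z(1)] by force
  next
    case (Suc n)
    then obtain z where z: "z \<in> Z" "norm (x - z) \<le> norm x / 2 ^ n" by blast
    obtain z' where z': "z' \<in> Z" "norm (x - z - z') \<le> norm (x - z) / 2" using step by blast
    have "norm (x - (z + z')) \<le> norm x / 2 ^ Suc n" using z(2) z'(2) by (simp add: diff_diff_add)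
    then show ?case using complex_subspace_add[OF Z(1) z(1) z'(1)] by blast
  qed
  have "x \<in> closure Z" for x
    unfolding closure_approachable
  proof (intro allI impI)
    fix e :: real assume "e > 0"
    have "(\<lambda>n. norm x / 2 ^ n) \<longlonglongrightarrow> 0" by real_asymp
    then obtain n where "norm x / 2 ^ n < e"
      using \<open>e > 0\<close> order_tendstoD(2) eventually_sequentially by (metis order_refl)
    then show "\<exists>z\<in>Z. dist z x < e"
      using iter[of x n] by (metis dist_norm norm_minus_commute order_le_less_trans)
  qed
  then show ?thesis using Z(2) by auto
qed

lemma dist_closed_complex_subspace:
  fixes Y :: "'a::complex_normed_vector set"
  assumes Y: "complex_subspace Y" "closed Y" and v: "v \<notin> Y"
  obtains d where "d > 0" "\<And>y a. y \<in> Y \<Longrightarrow> d * cmod a \<le> norm (y + a *\<^sub>C v)"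
proof -
  have "open (- Y)" "v \<in> - Y" using Y(2) v by auto
  then obtain d where d: "d > 0" "\<And>y. dist y v < d \<Longrightarrow> y \<notin> Y"
    unfolding open_dist by blast
  have "d * cmod a \<le> norm (y + a *\<^sub>C v)" if y: "y \<in> Y" for y a
  proof (cases "a = 0")
    case False
    have "(-1/a) *\<^sub>C y \<in> Y" using Y(1) y by (rule complex_subspace_scaleC)
    then have "d \<le> norm ((-1/a) *\<^sub>C y - v)" using d(2) by (metis dist_norm not_le)
    then have "d * cmod a \<le> norm ((-a) *\<^sub>C ((-1/a) *\<^sub>C y - v))"
      unfolding norm_scaleC norm_minus_cancel mult.commute[of d] by (rule mult_left_mono) simp
    also have "(-a) *\<^sub>C ((-1/a) *\<^sub>C y - v) = y + a *\<^sub>C v"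
      using False by (simp add: scaleC.diff_right scaleC_scaleC scaleC_one scaleC.minus_left scaleC.minus_right)
    finally show ?thesis .
  qed simp
  then show thesis using d(1) that by blast
qed

text \<open>For \<open>v \<notin> Y\<close> the map \<open>(y, a) \<mapsto> y + a v\<close> is bounded below on the complete space \<open>Y \<times> \<complex>\<close>, so
  its image is complete.\<close>

lemma closed_complex_subspace_plus_line:
  fixes Y :: "'a::complex_banach set"
  assumes Y: "complex_subspace Y" "closed Y"
  shows "complex_subspace {y + a *\<^sub>C v | y a. y \<in> Y}" "closed {y + a *\<^sub>C v | y a. y \<in> Y}"
proof -
  let ?W = "{y + a *\<^sub>C v | y a. y \<in> Y}"
  have WI: "y + a *\<^sub>C v \<in> ?W" if "y \<in> Y" for y a using that by blast
  show W: "complex_subspace ?W"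
    unfolding complex_subspace_def
  proof (intro conjI ballI allI)
    show "0 \<in> ?W" using WI[OF complex_subspace_0[OF Y(1)], of 0] by (simp add: scaleC.zero_left)
  next
    fix p q assume "p \<in> ?W" "q \<in> ?W"
    then obtain y a z b where "y \<in> Y" "z \<in> Y" "p = y + a *\<^sub>C v" "q = z + b *\<^sub>C v" by blast
    then show "p + q \<in> ?W"
      using WI[OF complex_subspace_add[OF Y(1), of y z], of "a + b"]
      by (simp add: scaleC_add_left algebra_simps)
  next
    fix c p assume "p \<in> ?W"
    then obtain y a where "y \<in> Y" "p = y + a *\<^sub>C v" by blast
    then show "c *\<^sub>C p \<in> ?W"
      using WI[OF complex_subspace_scaleC[OF Y(1), of y c], of "c * a"]
      by (simp add: scaleC_add_right scaleC_scaleC)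
  qed
  show "closed ?W"
  proof (cases "v \<in> Y")
    case True
    have "y \<in> ?W" if "y \<in> Y" for y using WI[OF that, of 0] by (simp add: scaleC.zero_left)
    moreover have "y + a *\<^sub>C v \<in> Y" if "y \<in> Y" for y a
      using that True Y(1) by (simp add: complex_subspace_add complex_subspace_scaleC)
    ultimately have "?W = Y" by blast
    then show ?thesis using Y(2) by simp
  next
    case False
    then obtain d where d: "d > 0" "\<And>y a. y \<in> Y \<Longrightarrow> d * cmod a \<le> norm (y + a *\<^sub>C v)"
      using dist_closed_complex_subspace[OF Y] by blast
    define f where "f = (\<lambda>(y, a). y + a *\<^sub>C v)"
    have "complete (f ` (Y \<times> UNIV))"
    proof (rule complete_isometric_image)
      show "bounded_linear f"
        unfolding f_def case_prod_beta
        by (intro bounded_linear_add bounded_linear_fst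
            bounded_linear_compose[OF scaleC.bounded_linear_left bounded_linear_snd])
      show "subspace (Y \<times> (UNIV :: complex set))"
        using complex_subspace_imp_subspace[OF Y(1)] by (simp add: subspace_Times)
      show "complete (Y \<times> (UNIV :: complex set))"
        using Y(2) by (simp add: complete_eq_closed closed_Times)
      let ?e = "1 / (1 + norm v / d + 1 / d)"
      have pos: "1 + norm v / d + 1 / d > 0" using d(1) by (simp add: add_pos_nonneg add_nonneg_pos)
      then show "?e > 0" by simp
      show "\<forall>p\<in>Y \<times> UNIV. ?e * norm p \<le> norm (f p)"
      proof
        fix p assume "p \<in> Y \<times> (UNIV :: complex set)"
        then obtain y a where p: "p = (y, a)" "y \<in> Y" by blast
        let ?n = "norm (y + a *\<^sub>C v)"
        have a: "cmod a \<le> ?n / d" using d(2)[OF p(2), of a] d(1) by (simp add: field_simps)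
        have "norm y \<le> ?n + cmod a * norm v"
          using norm_triangle_ineq4[of "y + a *\<^sub>C v" "a *\<^sub>C v"] by (simp add: norm_scaleC)
        also have "\<dots> \<le> ?n + ?n / d * norm v" using a by (intro add_left_mono mult_right_mono) auto
        finally have "norm p \<le> ?n + ?n / d * norm v + ?n / d"
          using a norm_Pair_le[of y a] unfolding p(1) by linarith
        also have "\<dots> = ?n * (1 + norm v / d + 1 / d)" by (simp add: algebra_simps)
        finally show "?e * norm p \<le> norm (f p)"
          using pos by (simp add: f_def p(1) pos_divide_le_eq)
      qed
    qed
    moreover have "f ` (Y \<times> UNIV) = ?W" by (auto simp: f_def)
    ultimately show ?thesis by (simp add: complete_eq_closed)
  qed
qed

text \<open>The hypothesis says that \<open>Y\<close> and the finite set \<open>F\<close> span a dense subspace. Such a \<open>Y\<close> is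
  the kernel of a continuous projection of finite rank, built one dimension at a time.\<close>

lemma finite_codimension_compact_projection:
  fixes Y :: "'a::complex_banach set"
  assumes "finite F" "complex_subspace Y" "closed Y"
    and "\<And>Z. complex_subspace Z \<Longrightarrow> closed Z \<Longrightarrow> Y \<subseteq> Z \<Longrightarrow> F \<subseteq> Z \<Longrightarrow> Z = UNIV"
  shows "\<exists>Q\<in>compact_operators. (\<forall>x. Q (Q x) = Q x) \<and> (\<forall>x. Q x = 0 \<longleftrightarrow> x \<in> Y)"
  using assms
proof (induction F arbitrary: Y rule: finite_induct)
  case empty
  then have "Y = UNIV" by blast
  then show ?case by (intro bexI[OF _ compact_operators_zero]) auto
next
  case (insert v F Y)
  show ?case
  proof (cases "v \<in> Y")
    case True
    show ?thesis
    proof (rule insert.IH[OF insert.prems(1,2)])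
      fix Z assume "complex_subspace Z" "closed Z" "Y \<subseteq> Z" "F \<subseteq> Z"
      then show "Z = UNIV" using True insert.prems(3) by blast
    qed
  next
    case False
    define Y1 where "Y1 = {y + a *\<^sub>C v | y a. y \<in> Y}"
    have Y1I: "y + a *\<^sub>C v \<in> Y1" if "y \<in> Y" for y a using that by (auto simp: Y1_def)
    have YY1: "Y \<subseteq> Y1" using Y1I[of _ 0] by (auto simp: scaleC.zero_left)
    have vY1: "v \<in> Y1"
      using Y1I[OF complex_subspace_0[OF insert.prems(1)], of 1] by (simp add: scaleC_one)
    have "\<exists>Q\<in>compact_operators. (\<forall>x. Q (Q x) = Q x) \<and> (\<forall>x. Q x = 0 \<longleftrightarrow> x \<in> Y1)"
    proof (rule insert.IH)
      show "complex_subspace Y1" "closed Y1"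
        unfolding Y1_def using closed_complex_subspace_plus_line[OF insert.prems(1,2)] by auto
      fix Z assume "complex_subspace Z" "closed Z" "Y1 \<subseteq> Z" "F \<subseteq> Z"
      then show "Z = UNIV" using YY1 vY1 insert.prems(3) by blast
    qed
    then obtain Q1 where Q1: "Q1 \<in> compact_operators" "\<And>x. Q1 (Q1 x) = Q1 x" "\<And>x. Q1 x = 0 \<longleftrightarrow> x \<in> Y1"
      by blast
    have lin: "bounded_clinear Q1" using Q1(1) by (rule compact_operators_bounded_clinear)
    obtain d where d: "d > 0" "\<And>y a. y \<in> Y \<Longrightarrow> d * cmod a \<le> norm (y + a *\<^sub>C v)"
      using dist_closed_complex_subspace[OF insert.prems(1,2) False] by blast
    \<comment> \<open>\<open>h\<close> is the coefficient of \<open>v\<close> in the component of its argument in \<open>Y1\<close>.\<close>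
    define h where "h x = (SOME a. x - Q1 x - a *\<^sub>C v \<in> Y)" for x
    have ex: "\<exists>a. x - Q1 x - a *\<^sub>C v \<in> Y" for x
    proof -
      have "Q1 (x - Q1 x) = 0" by (simp add: bounded_clinear_diff[OF lin] Q1(2))
      then obtain y a where "y \<in> Y" "x - Q1 x = y + a *\<^sub>C v" unfolding Q1(3) Y1_def by blast
      then have "x - Q1 x - a *\<^sub>C v \<in> Y" by simp
      then show ?thesis by blast
    qed
    have h: "x - Q1 x - h x *\<^sub>C v \<in> Y" for x unfolding h_def by (rule someI_ex[OF ex])
    have h_eq: "h x = a" if "x - Q1 x - a *\<^sub>C v \<in> Y" for x a
    proof -
      have "(x - Q1 x - a *\<^sub>C v) - (x - Q1 x - h x *\<^sub>C v) \<in> Y"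
        using complex_subspace_diff[OF insert.prems(1) that h] .
      from d(2)[OF this, of "a - h x"] have "d * cmod (a - h x) \<le> 0"
        by (simp add: scaleC.diff_left)
      then show ?thesis using d(1) by (simp add: mult_le_0_iff)
    qed
    have dual: "h \<in> dual_space"
    proof -
      obtain M where M: "M > 0" "\<And>x. norm (Q1 x) \<le> M * norm x"
        using bounded_clinear_pos_bound[OF lin] by blast
      have "bounded_clinear h"
      proof (rule bounded_clinearI)
        show "h (x + y) = h x + h y" for x y
          using complex_subspace_add[OF insert.prems(1) h[of x] h[of y]]
          by (intro h_eq) (simp add: bounded_clinear_add[OF lin] scaleC_add_left algebra_simps)
        show "h (c *\<^sub>C x) = c *\<^sub>C h x" for c x
          using complex_subspace_scaleC[OF insert.prems(1) h[of x], of c]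
          by (intro h_eq)
             (simp add: bounded_clinear_scaleC[OF lin] scaleC.diff_right scaleC_scaleC scaleC_complex_def)
        fix x
        have "d * cmod (h x) \<le> norm (x - Q1 x)" using d(2)[OF h[of x], of "h x"] by simp
        also have "\<dots> \<le> norm x + M * norm x" using norm_triangle_ineq4[of x "Q1 x"] M(2)[of x] by linarith
        finally show "cmod (h x) \<le> (1 + M) / d * norm x" using d(1) by (simp add: field_simps)
      qed
      then show ?thesis by simp
    qed
    define Q where "Q x = Q1 x + h x *\<^sub>C v" for x
    have hlin: "bounded_clinear h" using dual by simp
    have hQ1: "h (Q1 x) = 0" for x
      by (rule h_eq) (simp add: Q1(2) scaleC.zero_left complex_subspace_0[OF insert.prems(1)])
    have Q1v: "Q1 v = 0" using vY1 Q1(3) by blast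
    have hv: "h v = 1"
      by (rule h_eq) (simp add: Q1v scaleC_one complex_subspace_0[OF insert.prems(1)])
    have Q1Q: "Q1 (Q x) = Q1 x" for x
      by (simp add: Q_def bounded_clinear_simps[OF lin] Q1(2) Q1v scaleC.zero_right)
    have "Q (Q x) = Q x" for x
    proof -
      have "h (Q x) = h x"
        by (simp add: Q_def bounded_clinear_simps[OF hlin] hQ1 hv scaleC_complex_def)
      then have "Q1 (Q x) + h (Q x) *\<^sub>C v = Q1 x + h x *\<^sub>C v" by (simp add: Q1Q)
      then show ?thesis by (simp add: Q_def)
    qed
    moreover have "Q x = 0 \<longleftrightarrow> x \<in> Y" for x
    proof
      assume "Q x = 0"
      then have "Q1 x = 0" using Q1Q[of x] by (simp add: bounded_clinear_zero[OF lin])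
      then have "h x *\<^sub>C v = 0" using \<open>Q x = 0\<close> by (simp add: Q_def)
      then show "x \<in> Y" using h[of x] \<open>Q1 x = 0\<close> by simp
    next
      assume "x \<in> Y"
      then have "Q1 x = 0" using YY1 Q1(3) by blast
      moreover have "h x = 0" using \<open>x \<in> Y\<close> \<open>Q1 x = 0\<close> by (intro h_eq) (simp add: scaleC.zero_left)
      ultimately show "Q x = 0" by (simp add: Q_def scaleC.zero_left)
    qed
    moreover have "Q \<in> compact_operators"
      unfolding Q_def by (intro compact_operators_plus Q1(1) compact_operators_rank_one dual)
    ultimately show ?thesis by blast
  qed
qed

section \<open>Stability of essential invertibility\<close>

lemma compact_operator_finite_net:
  assumes "L \<in> compact_operators" "e > 0"
  obtains E where "finite E" "\<And>x. x \<in> E \<Longrightarrow> norm x \<le> 1"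
    "\<And>x. norm x \<le> 1 \<Longrightarrow> \<exists>y\<in>E. norm (L x - L y) < e"
proof -
  let ?B = "cball 0 1 :: 'a set"
  have "compact (closure (L ` ?B))" using assms(1) by (simp add: compact_operators_def)
  moreover have "closure (L ` ?B) \<subseteq> (\<Union>x\<in>?B. ball (L x) e)"
    using assms(2) by (auto simp: closure_approachable)
  moreover have "open (ball (L x) e)" for x by simp
  ultimately obtain E where E: "E \<subseteq> ?B" "finite E" "closure (L ` ?B) \<subseteq> (\<Union>x\<in>E. ball (L x) e)"
    by (metis (lifting) compactE_image)
  have "\<exists>y\<in>E. norm (L x - L y) < e" if "norm x \<le> 1" for x
  proof -
    have "L x \<in> closure (L ` ?B)" by (rule subsetD[OF closure_subset]) (use that in auto)
    then show ?thesis using E(3) by (force simp: dist_norm norm_minus_commute[of "L x"])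
  qed
  moreover have "norm x \<le> 1" if "x \<in> E" for x using that E(1) by auto
  ultimately show thesis using that[of E] E(2) by blast
qed

text \<open>An operator that is bounded below on a closed subspace \<open>ker P\<close> of finite codimension is
  essentially invertible as soon as \<open>ker P\<close> has an image of finite codimension: invert it from
  that image back to \<open>ker P\<close>, and send a complement of the image to \<open>0\<close>.\<close>

lemma essentially_invertible_of_bounded_below:
  fixes S :: "'a::complex_banach \<Rightarrow> 'a"
  assumes S: "bounded_clinear S"
    and P: "P \<in> compact_operators" "\<And>x. P (P x) = P x"
    and Q: "Q \<in> compact_operators" "\<And>x. Q (Q x) = Q x" "\<And>x. Q x = 0 \<longleftrightarrow> x \<in> S ` {x. P x = 0}"
    and c: "c > 0" "\<And>x. P x = 0 \<Longrightarrow> c * norm x \<le> norm (S x)"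
  shows "essentially_invertible S"
proof -
  have linP: "bounded_clinear P" and linQ: "bounded_clinear Q"
    using P(1) Q(1) compact_operators_bounded_clinear by auto
  define R where "R x = (SOME m. P m = 0 \<and> S m = x - Q x)" for x
  have R: "P (R x) = 0 \<and> S (R x) = x - Q x" for x
    unfolding R_def
  proof (rule someI_ex)
    have "Q (x - Q x) = 0" by (simp add: bounded_clinear_diff[OF linQ] Q(2))
    then obtain m where "P m = 0" "x - Q x = S m" unfolding Q(3) by blast
    then show "\<exists>m. P m = 0 \<and> S m = x - Q x" by auto
  qed
  have R_eq: "R x = m" if "P m = 0" "S m = x - Q x" for x m
  proof -
    have "P (R x - m) = 0" "S (R x - m) = 0"
      using R that by (simp_all add: bounded_clinear_diff[OF linP] bounded_clinear_diff[OF S])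
    then show ?thesis using c(2)[of "R x - m"] c(1) by (simp add: mult_le_0_iff)
  qed
  obtain M where M: "M > 0" "\<And>x. norm (Q x) \<le> M * norm x"
    using bounded_clinear_pos_bound[OF linQ] by blast
  have linR: "bounded_clinear R"
  proof (rule bounded_clinearI)
    show "R (x + y) = R x + R y" for x y
      using R by (intro R_eq) (simp_all add: bounded_clinear_add linP linQ S)
    show "R (a *\<^sub>C x) = a *\<^sub>C R x" for a x
      using R by (intro R_eq)
        (simp_all add: bounded_clinear_scaleC linP linQ S scaleC.zero_right scaleC.diff_right)
    fix x
    have "c * norm (R x) \<le> norm (x - Q x)" using c(2)[of "R x"] R[of x] by simp
    also have "\<dots> \<le> norm x + M * norm x" using norm_triangle_ineq4[of x "Q x"] M(2)[of x] by linarith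
    finally show "norm (R x) \<le> (1 + M) / c * norm x" using c(1) by (simp add: field_simps)
  qed
  have RS: "R (S x) = x" if "P x = 0" for x
  proof (rule R_eq[OF that])
    have "Q (S x) = 0" using that Q(3) by blast
    then show "S x = S x - Q (S x)" by simp
  qed
  have "R (S x) - x = R (S (P x)) - P x" for x
  proof -
    have "R (S (x - P x)) = x - P x" by (rule RS) (simp add: bounded_clinear_diff[OF linP] P(2))
    then show ?thesis
      by (simp add: bounded_clinear_diff[OF S] bounded_clinear_diff[OF linR] algebra_simps)
  qed
  moreover have "(\<lambda>x. R (S (P x)) - P x) \<in> compact_operators"
    by (intro compact_operators_minus P(1) compact_operators_comp_left[OF P(1)]
        compact_operators_comp_left[OF compact_operators_comp_left[OF P(1)]] S linR)
  moreover have "S (R x) - x = 0 - Q x" for x using R[of x] by simp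
  moreover have "(\<lambda>x. 0 - Q x) \<in> compact_operators"
    by (intro compact_operators_minus compact_operators_zero Q(1))
  ultimately show ?thesis
    unfolding essentially_invertible_def using S linR by auto
qed

text \<open>If \<open>S'\<close> is essentially invertible, every \<open>x\<close> in the unit ball is \<open>S' m\<close> with \<open>m \<in> ker P\<close> up
  to an error from a relatively compact set, hence \<open>x \<approx> e + S' w\<close> with \<open>e\<close> from a finite set and
  \<open>w \<in> ker P\<close>. As \<open>S'\<close> is bounded below on \<open>ker P\<close>, the norm of \<open>w\<close> is controlled, and \<open>S'\<close> may be
  replaced by \<open>S\<close>. It is essential that the admissible distance between \<open>S\<close> and \<open>S'\<close> depends on
  the lower bound \<open>c\<close> alone: so \<open>S\<close> and \<open>S'\<close> may exchange their roles.\<close>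

lemma essentially_invertible_perturb:
  fixes S S' :: "'a::complex_banach \<Rightarrow> 'a"
  assumes S: "bounded_clinear S" and S': "essentially_invertible S'"
    and P: "P \<in> compact_operators" "\<And>x. P (P x) = P x"
    and c: "c > 0" "\<And>x. P x = 0 \<Longrightarrow> c * norm x \<le> norm (S x)"
    and close: "\<And>x. norm (S x - S' x) \<le> c / 10 * norm x"
  shows "essentially_invertible S"
proof -
  have linP: "bounded_clinear P" using P(1) by (rule compact_operators_bounded_clinear)
  obtain R where R: "bounded_clinear R" "(\<lambda>x. S' (R x) - x) \<in> compact_operators"
    using S' by (auto simp: essentially_invertible_def)
  have linS': "bounded_clinear S'" using S' by (simp add: essentially_invertible_def)
  define L where "L x = S' (P (R x)) - (S' (R x) - x)" for x
  define m where "m x = R x - P (R x)" for x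
  have L: "L \<in> compact_operators"
    unfolding L_def by (intro compact_operators_minus R(2)
        compact_operators_comp_left[OF compact_operators_comp_right[OF P(1) R(1)] linS'])
  have split: "x = S' (m x) + L x" for x
    by (simp add: L_def m_def bounded_clinear_diff[OF linS'])
  have Pm: "P (m x) = 0" for x by (simp add: m_def bounded_clinear_diff[OF linP] P(2))
  \<comment> \<open>With \<open>1/10\<close> here and \<open>c / 10\<close> in the hypothesis, the final error is at most \<open>1/10 + 7/30\<close>.\<close>
  obtain E where E: "finite E" "\<And>x. x \<in> E \<Longrightarrow> norm x \<le> 1"
    "\<And>x. norm x \<le> 1 \<Longrightarrow> \<exists>y\<in>E. norm (L x - L y) < 1/10"
    using compact_operator_finite_net[OF L, of "1/10"] by (metis zero_less_divide_1_iff zero_less_numeral)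
  have approx: "\<exists>e\<in>E. \<exists>w. P w = 0 \<and> norm (x - (e + S w)) \<le> 1/2" if x: "norm x \<le> 1" for x
  proof -
    obtain e where e: "e \<in> E" "norm (L x - L e) < 1/10" using E(3)[OF x] by blast
    define w where "w = m x - m e"
    have Pw: "P w = 0" by (simp add: w_def bounded_clinear_diff[OF linP] Pm)
    have xe: "x - e = S' w + (L x - L e)"
      using split[of x] split[of e] unfolding w_def
      by (simp add: bounded_clinear_diff[OF linS'] algebra_simps)
    have "norm (S' w) \<le> norm (x - e) + norm (L x - L e)"
      using norm_triangle_ineq4[of "x - e" "L x - L e"] by (simp add: xe)
    moreover have "norm (x - e) \<le> 2" using norm_triangle_ineq4[of x e] x E(2)[OF e(1)] by linarith
    moreover have "c * norm w \<le> norm (S' w) + c / 10 * norm w"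
      using c(2)[OF Pw] close[of w] norm_triangle_ineq2[of "S w" "S' w"] by linarith
    ultimately have "c * norm w \<le> 7/3" using e(2) by simp
    moreover have "x - (e + S w) = (S' w - S w) + (L x - L e)" using xe by (simp add: algebra_simps)
    then have "norm (x - (e + S w)) \<le> norm (S' w - S w) + norm (L x - L e)"
      by (metis norm_triangle_ineq)
    ultimately have "norm (x - (e + S w)) \<le> 1/2"
      using close[of w] e(2) norm_minus_commute[of "S w" "S' w"] by linarith
    then show ?thesis using e(1) Pw by blast
  qed
  let ?Y = "S ` {x. P x = 0}"
  have kerP: "complex_subspace {x. P x = 0}"
    by (simp add: complex_subspace_def bounded_clinear_simps[OF linP] scaleC.zero_right)
  have Y: "complex_subspace ?Y"
    unfolding complex_subspace_def
  proof (intro conjI ballI allI)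
    show "0 \<in> ?Y" using complex_subspace_0[OF kerP] bounded_clinear_zero[OF S] by (metis image_eqI)
    show "p + q \<in> ?Y" if "p \<in> ?Y" "q \<in> ?Y" for p q
      using that complex_subspace_add[OF kerP] bounded_clinear_add[OF S] by (smt (verit) imageE image_eqI)
    show "a *\<^sub>C p \<in> ?Y" if "p \<in> ?Y" for a p
      using that complex_subspace_scaleC[OF kerP] bounded_clinear_scaleC[OF S] by (smt (verit) imageE image_eqI)
  qed
  have "closed {x. P x = 0}"
    using continuous_closed_vimage[of "{0}" P] bounded_clinear_bounded_linear[OF linP]
    by (simp add: linear_continuous_at vimage_def)
  then have "complete ?Y"
    using c complex_subspace_imp_subspace[OF kerP] bounded_clinear_bounded_linear[OF S]
    by (intro complete_isometric_image[where e = c]) (auto simp: complete_eq_closed)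
  then have "closed ?Y" by (simp add: complete_eq_closed)
  have "\<exists>Q\<in>compact_operators. (\<forall>x. Q (Q x) = Q x) \<and> (\<forall>x. Q x = 0 \<longleftrightarrow> x \<in> ?Y)"
  proof (rule finite_codimension_compact_projection[OF E(1) Y \<open>closed ?Y\<close>])
    fix Z assume Z: "complex_subspace Z" "closed Z" "?Y \<subseteq> Z" "E \<subseteq> Z"
    show "Z = UNIV"
    proof (rule complex_subspace_eq_UNIV[OF Z(1,2)])
      fix x :: 'a assume "norm x \<le> 1"
      then obtain e w where ew: "e \<in> E" "P w = 0" "norm (x - (e + S w)) \<le> 1/2"
        using approx by blast
      have "e \<in> Z" "S w \<in> Z" using ew(1,2) Z(3,4) by auto
      then show "\<exists>z\<in>Z. norm (x - z) \<le> 1/2" using complex_subspace_add[OF Z(1)] ew(3) by blast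
    qed
  qed
  then show ?thesis
    using essentially_invertible_of_bounded_below[OF S P _ _ _ c] by blast
qed

section \<open>Zenger's lemma\<close>

text \<open>The \<open>z i\<close> maximise \<open>\<Prod>i\<in>I. cmod (z i) powr p i\<close> subject to
  \<open>norm (\<Sum>i\<in>I. z i *\<^sub>C x i) \<le> 1\<close>; the independence of the \<open>x i\<close> makes the feasible set compact. The
  last inequality is maximality, tested at \<open>z + t a\<close> after scaling it back into the unit ball. The
  objective is homogeneous of degree at most \<open>1\<close>, which bounds the effect of the scaling.\<close>

lemma zenger_maximizer:
  fixes x :: "'i \<Rightarrow> 'a::complex_normed_vector" and p :: "'i \<Rightarrow> real"
  assumes I: "finite I" and p: "\<And>i. i \<in> I \<Longrightarrow> p i > 0" "sum p I \<le> 1"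
    and indep: "\<And>a i. i \<in> I \<Longrightarrow> cmod (a i) \<le> C * norm (\<Sum>i\<in>I. a i *\<^sub>C x i)"
  shows "\<exists>z. (\<forall>i\<in>I. z i \<noteq> 0) \<and> norm (\<Sum>i\<in>I. z i *\<^sub>C x i) \<le> 1 \<and>
    (\<forall>a. \<forall>t>0. (\<Prod>i\<in>I. cmod (z i + of_real t * a i) powr p i)
      \<le> (1 + t * norm (\<Sum>i\<in>I. a i *\<^sub>C x i)) * (\<Prod>i\<in>I. cmod (z i) powr p i))"
proof -
  define N where "N a = norm (\<Sum>i\<in>I. a i *\<^sub>C x i)" for a
  define f where "f a = (\<Prod>i\<in>I. cmod (a i) powr p i)" for a :: "'i \<Rightarrow> complex"
  define K where "K = (\<Pi>\<^sub>E i\<in>UNIV. if i \<in> I then cball 0 C else {0}) \<inter> {a. N a \<le> 1}"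
  have K_I: "a \<in> K" if "N a \<le> 1" "\<And>i. i \<notin> I \<Longrightarrow> a i = 0" for a
  proof -
    have "cmod (a i) \<le> C" if "i \<in> I" for i
    proof -
      have "0 \<le> C"
        using indep[of i "\<lambda>_. 1"] that norm_ge_zero[of "1::complex"] \<open>i \<in> I\<close>
        by (smt (verit) mult_neg_pos norm_ge_zero norm_one zero_less_mult_iff)
      then show ?thesis
        using indep[OF that, of a] \<open>N a \<le> 1\<close> mult_left_mono[of "N a" 1 C] by (simp add: N_def)
    qed
    then show ?thesis using that by (simp add: K_def PiE_iff)
  qed
  have contN: "continuous_on UNIV N"
    unfolding N_def by (intro continuous_intros continuous_on_norm continuous_on_sum
        bounded_linear.continuous_on[OF scaleC.bounded_linear_left] continuous_on_product_coordinates)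
  have "compactin (product_topology (\<lambda>i. euclidean) UNIV) (\<Pi>\<^sub>E i\<in>UNIV. if i \<in> I then cball (0::complex) C else {0})"
    by (auto simp: compactin_PiE compactin_euclidean_iff)
  then have "compact (\<Pi>\<^sub>E i\<in>UNIV. if i \<in> I then cball (0::complex) C else {0})"
    by (simp add: euclidean_product_topology compactin_euclidean_iff)
  moreover have "closed {a. N a \<le> 1}"
    using contN by (intro closed_Collect_le) auto
  ultimately have "compact K" unfolding K_def by (rule compact_Int_closed)
  moreover have "continuous_on K f"
    unfolding f_def
    by (intro continuous_on_prod continuous_on_powr' continuous_on_norm continuous_on_const
        continuous_on_subset[OF continuous_on_product_coordinates]) (use p in auto)
  moreover have "(\<lambda>i. 0) \<in> K" by (intro K_I) (simp_all add: N_def scaleC.zero_left)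
  ultimately obtain z where z: "z \<in> K" "\<And>a. a \<in> K \<Longrightarrow> f a \<le> f z"
    using continuous_attains_sup[of K f] by blast
  have Nz: "N z \<le> 1" and z0: "\<And>i. i \<notin> I \<Longrightarrow> z i = 0" using z(1) by (auto simp: K_def PiE_iff split: if_splits)
  have f_scale: "f (\<lambda>i. of_real r * a i) = r powr (sum p I) * f a" if "r > 0" for r a
  proof -
    have "f (\<lambda>i. of_real r * a i) = (\<Prod>i\<in>I. r powr p i * cmod (a i) powr p i)"
      unfolding f_def using that by (simp add: norm_mult powr_mult)
    then show ?thesis using that I by (simp add: f_def prod.distrib powr_sum)
  qed
  have N_scale: "N (\<lambda>i. of_real r * a i) = r * N a" if "r > 0" for r a
  proof -
    have "(\<Sum>i\<in>I. (of_real r * a i) *\<^sub>C x i) = of_real r *\<^sub>C (\<Sum>i\<in>I. a i *\<^sub>C x i)"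
      by (simp add: scaleC.sum_right scaleC_scaleC)
    then show ?thesis using that by (simp add: N_def norm_scaleC)
  qed
  have f_nonneg: "f a \<ge> 0" for a by (simp add: f_def prod_nonneg)
  \<comment> \<open>Rescaling an arbitrary vector into the feasible set.\<close>
  have max: "f a \<le> r * f z" if "N a \<le> r" "r \<ge> 1" "\<And>i. i \<notin> I \<Longrightarrow> a i = 0" for a r
  proof -
    have "(\<lambda>i. of_real (1/r) * a i) \<in> K"
    proof (rule K_I)
      have "N (\<lambda>i. of_real (1/r) * a i) = (1/r) * N a" using that by (intro N_scale) simp
      also have "\<dots> \<le> 1" using that by (simp add: divide_simps)
      finally show "N (\<lambda>i. of_real (1/r) * a i) \<le> 1" .
    qed (simp add: that)
    from z(2)[OF this] have "(1/r) powr (sum p I) * f a \<le> f z"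
      using that f_scale[of "1/r" a] by simp
    then have "f a \<le> r powr (sum p I) * f z"
      using that by (simp add: powr_divide divide_simps mult.commute split: if_splits)
    also have "\<dots> \<le> r powr 1 * f z"
      using that p(2) f_nonneg by (intro mult_right_mono powr_mono) auto
    finally show ?thesis using that by simp
  qed
  have "f z > 0"
  proof -
    define a :: "'i \<Rightarrow> complex" where "a i = (if i \<in> I then 1 else 0)" for i
    have "f a = 1" by (simp add: f_def a_def)
    then have "1 \<le> max 1 (N a) * f z" using max[of a "max 1 (N a)"] by (simp add: a_def)
    then show ?thesis using f_nonneg[of z] by (cases "f z = 0") auto
  qed
  have znz: "z i \<noteq> 0" if "i \<in> I" for i
  proof
    assume "z i = 0"
    then have "f z = 0" unfolding f_def using that I by (intro prod_zero) (auto intro!: bexI[of _ i])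
    then show False using \<open>f z > 0\<close> by simp
  qed
  show ?thesis
  proof (intro exI[of _ z] conjI ballI allI impI)
    show "z i \<noteq> 0" if "i \<in> I" for i using that by (rule znz)
    show "norm (\<Sum>i\<in>I. z i *\<^sub>C x i) \<le> 1" using Nz by (simp add: N_def)
    fix a and t :: real assume t: "t > 0"
    define b where "b i = (if i \<in> I then z i + of_real t * a i else 0)" for i
    have "(\<Sum>i\<in>I. b i *\<^sub>C x i) = (\<Sum>i\<in>I. z i *\<^sub>C x i) + of_real t *\<^sub>C (\<Sum>i\<in>I. a i *\<^sub>C x i)"
      by (simp add: b_def scaleC_add_left sum.distrib scaleC.sum_right scaleC_scaleC)
    then have "N b \<le> N z + t * N a"
      using norm_triangle_ineq[of "\<Sum>i\<in>I. z i *\<^sub>C x i" "of_real t *\<^sub>C (\<Sum>i\<in>I. a i *\<^sub>C x i)"] t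
      by (simp add: N_def norm_scaleC)
    then have "N b \<le> 1 + t * N a" using Nz by simp
    moreover have "N a \<ge> 0" by (simp add: N_def)
    ultimately have "f b \<le> (1 + t * N a) * f z" using t by (intro max) (auto simp: b_def)
    moreover have "f b = (\<Prod>i\<in>I. cmod (z i + of_real t * a i) powr p i)"
      unfolding f_def by (intro prod.cong) (auto simp: b_def)
    ultimately show "(\<Prod>i\<in>I. cmod (z i + of_real t * a i) powr p i)
      \<le> (1 + t * norm (\<Sum>i\<in>I. a i *\<^sub>C x i)) * (\<Prod>i\<in>I. cmod (z i) powr p i)"
      by (simp add: f_def N_def)
  qed
qed

text \<open>Put \<open>F (x i) = p i / z i\<close> for the maximiser \<open>z\<close>; this is the derivative at \<open>z\<close> of the logarithm
  of the objective. The first-order condition for a maximum says precisely that the real part of \<open>F\<close>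
  is dominated by the norm on the span of the \<open>x i\<close>, so \<open>F\<close> extends by the Hahn-Banach theorem.\<close>

lemma zenger:
  fixes x :: "'i \<Rightarrow> 'a::complex_normed_vector" and p :: "'i \<Rightarrow> real"
  assumes I: "finite I" and p: "\<And>i. i \<in> I \<Longrightarrow> p i > 0" "sum p I = 1"
    and indep: "\<And>a i. i \<in> I \<Longrightarrow> cmod (a i) \<le> C * norm (\<Sum>i\<in>I. a i *\<^sub>C x i)"
  obtains z F where "((\<Sum>i\<in>I. z i *\<^sub>C x i), F) \<in> normed_pairs"
    "\<And>v. cmod (F v) \<le> norm v" "\<And>i. i \<in> I \<Longrightarrow> z i * F (x i) = p i"
proof -
  obtain z where z: "\<And>i. i \<in> I \<Longrightarrow> z i \<noteq> 0" "norm (\<Sum>i\<in>I. z i *\<^sub>C x i) \<le> 1"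
    "\<And>a t. t > 0 \<Longrightarrow> (\<Prod>i\<in>I. cmod (z i + of_real t * a i) powr p i)
      \<le> (1 + t * norm (\<Sum>i\<in>I. a i *\<^sub>C x i)) * (\<Prod>i\<in>I. cmod (z i) powr p i)"
    using zenger_maximizer[OF I p(1) eq_refl[OF p(2)] indep] by blast
  have dom: "Re (\<Sum>i\<in>I. a i * (p i / z i)) \<le> norm (\<Sum>i\<in>I. a i *\<^sub>C x i)" for a
  proof -
    define r where "r = norm (\<Sum>i\<in>I. a i *\<^sub>C x i)"
    define q where "q i = a i / z i" for i
    \<comment> \<open>The logarithm of the objective along the direction \<open>a\<close>, relative to its value at \<open>z\<close>.\<close>
    define g where "g t = (\<Sum>i\<in>I. p i * (ln ((1 + t * Re (q i))\<^sup>2 + (t * Im (q i))\<^sup>2) / 2))" for t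
    have "(g has_real_derivative (\<Sum>i\<in>I. p i * Re (q i))) (at 0)"
      unfolding g_def by (auto intro!: derivative_eq_intros sum.cong)
    then have lim: "(\<lambda>t. (g t - g 0) / t) \<midarrow>0\<rightarrow> (\<Sum>i\<in>I. p i * Re (q i))"
      unfolding DERIV_def by simp
    then have "((\<lambda>t. (g t - g 0) / t) \<longlongrightarrow> (\<Sum>i\<in>I. p i * Re (q i))) (at_right 0)"
      by (rule filterlim_mono[OF _ order_refl at_le]) simp
    moreover have "eventually (\<lambda>t. (g t - g 0) / t \<le> r) (at_right 0)"
    proof -
      have "eventually (\<lambda>t. \<forall>i\<in>I. (1 + t * Re (q i))\<^sup>2 + (t * Im (q i))\<^sup>2 > 0) (at_right 0)"
      proof (rule eventually_ball_finite[OF I], rule ballI)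
        fix i
        have "((\<lambda>t. (1 + t * Re (q i))\<^sup>2 + (t * Im (q i))\<^sup>2) \<longlongrightarrow> (1 + 0 * Re (q i))\<^sup>2 + (0 * Im (q i))\<^sup>2) (at_right 0)"
          by (intro tendsto_intros)
        then show "eventually (\<lambda>t. (1 + t * Re (q i))\<^sup>2 + (t * Im (q i))\<^sup>2 > 0) (at_right 0)"
          by (rule order_tendstoD) simp
      qed
      then show ?thesis
        using eventually_at_right_less[of 0]
      proof eventually_elim
        case (elim t)
        have cm: "cmod (1 + of_real t * q i) = sqrt ((1 + t * Re (q i))\<^sup>2 + (t * Im (q i))\<^sup>2)" for i
          by (simp add: cmod_def)
        have pos: "cmod (1 + of_real t * q i) > 0" if "i \<in> I" for i
          using elim(1) that unfolding cm by simp
        have "(\<Prod>i\<in>I. cmod (z i + of_real t * a i) powr p i)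
            = (\<Prod>i\<in>I. cmod (1 + of_real t * q i) powr p i) * (\<Prod>i\<in>I. cmod (z i) powr p i)"
        proof -
          have "z i + of_real t * a i = (1 + of_real t * q i) * z i" if "i \<in> I" for i
            using z(1)[OF that] by (simp add: q_def algebra_simps)
          then show ?thesis by (simp add: norm_mult powr_mult flip: prod.distrib)
        qed
        moreover have "(\<Prod>i\<in>I. cmod (z i) powr p i) > 0"
          using z(1) by (intro prod_pos) auto
        ultimately have "(\<Prod>i\<in>I. cmod (1 + of_real t * q i) powr p i) \<le> 1 + t * r"
          using z(3)[OF elim(2), of a] by (simp add: r_def)
        moreover have "(\<Prod>i\<in>I. cmod (1 + of_real t * q i) powr p i) = exp (g t)"
          unfolding g_def exp_sum[OF I]
        proof (intro prod.cong refl)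
          fix i assume "i \<in> I"
          then show "cmod (1 + of_real t * q i) powr p i
              = exp (p i * (ln ((1 + t * Re (q i))\<^sup>2 + (t * Im (q i))\<^sup>2) / 2))"
            using pos[of i] ln_sqrt[of "(1 + t * Re (q i))\<^sup>2 + (t * Im (q i))\<^sup>2"] elim(1)
            unfolding powr_def cm by auto
        qed
        moreover have "1 + t * r \<le> exp (t * r)" by (rule exp_ge_add_one_self)
        ultimately have "g t \<le> t * r" by (metis exp_le_cancel_iff order_trans)
        moreover have "g 0 = 0" by (simp add: g_def)
        ultimately show ?case using elim(2) by (simp add: divide_simps mult.commute)
      qed
    qed
    ultimately have "(\<Sum>i\<in>I. p i * Re (q i)) \<le> r"
      by (rule tendsto_upperbound) simp
    moreover have "Re (\<Sum>i\<in>I. a i * (p i / z i)) = (\<Sum>i\<in>I. p i * Re (q i))"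
      unfolding Re_sum
    proof (intro sum.cong refl)
      fix i
      have "a i * (p i / z i) = of_real (p i) * q i" by (simp add: q_def)
      then show "Re (a i * (p i / z i)) = p i * Re (q i)" by simp
    qed
    ultimately show ?thesis by (simp add: r_def)
  qed
  obtain F where F: "F \<in> dual_space" "\<And>v. cmod (F v) \<le> norm v" "\<And>i. i \<in> I \<Longrightarrow> F (x i) = p i / z i"
    using hahn_banach_interpolation[OF I dom] by blast
  have zF: "z i * F (x i) = p i" if "i \<in> I" for i using z(1)[OF that] F(3)[OF that] by simp
  define v where "v = (\<Sum>i\<in>I. z i *\<^sub>C x i)"
  have linF: "bounded_clinear F" using F(1) by simp
  have "F v = (\<Sum>i\<in>I. z i * F (x i))"
    by (simp add: v_def bounded_clinear_sum[OF linF] bounded_clinear_scaleC[OF linF] scaleC_complex_def)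
  also have "\<dots> = of_real (sum p I)" by (simp add: zF)
  finally have Fv: "F v = 1" using p(2) by simp
  then have v: "norm v = 1" using F(2)[of v] z(2) by (simp add: v_def)
  have "onorm F = 1"
  proof (rule antisym)
    show "onorm F \<le> 1" using F(2) by (intro onorm_bound) auto
    show "1 \<le> onorm F"
      using onorm[OF bounded_clinear_bounded_linear[OF linF], of v] Fv v by simp
  qed
  then have "(v, F) \<in> normed_pairs" using F(1) Fv v by (simp add: normed_pairs_def)
  then show thesis using that[of z F] F(2) zF by (simp add: v_def)
qed

section \<open>The essential approximate point spectrum\<close>

text \<open>A compact idempotent has finite rank, and the closed subspaces of finite codimension are exactly
  the kernels of bounded idempotents of finite rank. So this is boundedness from below on a closed
  subspace of finite codimension; on a Banach space it is the upper semi-Fredholm property.\<close>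

definition essentially_bounded_below :: "('a::complex_normed_vector \<Rightarrow> 'a) \<Rightarrow> bool"
  where "essentially_bounded_below S \<longleftrightarrow>
    (\<exists>P\<in>compact_operators. (\<forall>x. P (P x) = P x) \<and> (\<exists>c>0. \<forall>x. P x = 0 \<longrightarrow> c * norm x \<le> norm (S x)))"

definition essential_approximate_spectrum :: "('a::complex_normed_vector \<Rightarrow> 'a) \<Rightarrow> complex set"
  where "essential_approximate_spectrum T = {l. \<not> essentially_bounded_below (\<lambda>x. T x - l *\<^sub>C x)}"

lemma essentially_bounded_belowI:
  assumes "P \<in> compact_operators" "\<And>x. P (P x) = P x" "c > 0"
    "\<And>x. P x = 0 \<Longrightarrow> c * norm x \<le> norm (S x)"
  shows "essentially_bounded_below S"
  using assms unfolding essentially_bounded_below_def by blast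

lemma bounded_below_imp_essentially_bounded_below:
  assumes "c > 0" "\<And>x. c * norm x \<le> norm (S x)"
  shows "essentially_bounded_below S"
  using assms by (intro essentially_bounded_belowI[OF compact_operators_zero]) auto

lemma essentially_bounded_belowE:
  assumes "essentially_bounded_below S"
  obtains P c where "P \<in> compact_operators" "\<And>x. P (P x) = P x" "c > 0"
    "\<And>x. P x = 0 \<Longrightarrow> c * norm x \<le> norm (S x)"
  using assms unfolding essentially_bounded_below_def by blast

lemma compact_essential_approximate_spectrum:
  fixes T :: "'a::complex_normed_vector \<Rightarrow> 'a"
  assumes T: "bounded_clinear T"
  shows "compact (essential_approximate_spectrum T)"
proof -
  obtain K where K: "K > 0" "\<And>x. norm (T x) \<le> K * norm x"
    using bounded_clinear_pos_bound[OF T] by blast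
  have "cmod l \<le> K" if l: "l \<in> essential_approximate_spectrum T" for l
  proof (rule ccontr)
    assume "\<not> cmod l \<le> K"
    then have "essentially_bounded_below (\<lambda>x. T x - l *\<^sub>C x)"
    proof (intro bounded_below_imp_essentially_bounded_below[where c = "cmod l - K"])
      fix x
      show "(cmod l - K) * norm x \<le> norm (T x - l *\<^sub>C x)"
        using norm_triangle_ineq2[of "l *\<^sub>C x" "T x"] K(2)[of x]
        by (simp add: norm_scaleC norm_minus_commute[of "T x"] left_diff_distrib)
    qed simp
    then show False using l by (simp add: essential_approximate_spectrum_def)
  qed
  then have "bounded (essential_approximate_spectrum T)"
    by (auto simp: bounded_iff)
  moreover have "open (- essential_approximate_spectrum T)"
    unfolding open_dist
  proof
    fix l assume "l \<in> - essential_approximate_spectrum T"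
    then have "essentially_bounded_below (\<lambda>x. T x - l *\<^sub>C x)"
      by (simp add: essential_approximate_spectrum_def)
    then obtain P c where P: "P \<in> compact_operators" "\<And>x. P (P x) = P x" "c > 0"
      "\<And>x. P x = 0 \<Longrightarrow> c * norm x \<le> norm (T x - l *\<^sub>C x)"
      using essentially_bounded_belowE by blast
    have "k \<in> - essential_approximate_spectrum T" if k: "dist k l < c / 2" for k
    proof -
      have "c / 2 * norm x \<le> norm (T x - k *\<^sub>C x)" if "P x = 0" for x
      proof -
        have "T x - l *\<^sub>C x = (T x - k *\<^sub>C x) + (k - l) *\<^sub>C x" by (simp add: scaleC.diff_left)
        then have "norm (T x - l *\<^sub>C x) \<le> norm (T x - k *\<^sub>C x) + cmod (k - l) * norm x"
          using norm_triangle_ineq by (metis norm_scaleC)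
        moreover have "cmod (k - l) * norm x \<le> c / 2 * norm x"
          using k by (intro mult_right_mono) (auto simp: dist_norm)
        ultimately show ?thesis using P(4)[OF that] by simp
      qed
      then show ?thesis
        using essentially_bounded_belowI[OF P(1,2), of "c / 2"] P(3)
        by (simp add: essential_approximate_spectrum_def)
    qed
    then show "\<exists>e>0. \<forall>k. dist k l < e \<longrightarrow> k \<in> - essential_approximate_spectrum T"
      using P(3) by (intro exI[of _ "c / 2"]) auto
  qed
  ultimately show ?thesis by (simp add: compact_eq_bounded_closed closed_def)
qed

text \<open>Every \<open>S'\<close> close to \<open>S\<close> is bounded below on the same subspace with a constant of the same
  order, so the perturbation lemma applies in both directions.\<close>

lemma essentially_invertible_locally_constant:
  fixes S :: "'a::complex_banach \<Rightarrow> 'a"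
  assumes S: "bounded_clinear S" "essentially_bounded_below S"
  obtains d where "d > 0" "\<And>S'. bounded_clinear S' \<Longrightarrow> (\<And>x. norm (S x - S' x) \<le> d * norm x)
    \<Longrightarrow> essentially_invertible S \<longleftrightarrow> essentially_invertible S'"
proof -
  obtain P c where P: "P \<in> compact_operators" "\<And>x. P (P x) = P x" "c > 0"
    "\<And>x. P x = 0 \<Longrightarrow> c * norm x \<le> norm (S x)"
    using essentially_bounded_belowE[OF S(2)] by blast
  \<comment> \<open>\<open>S'\<close> is bounded below by \<open>c / 2\<close>, and \<open>c / 20\<close> is a tenth of that.\<close>
  have "essentially_invertible S \<longleftrightarrow> essentially_invertible S'"
    if S': "bounded_clinear S'" and close: "\<And>x. norm (S x - S' x) \<le> c / 20 * norm x" for S'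
  proof
    assume "essentially_invertible S'"
    moreover have "norm (S x - S' x) \<le> c / 10 * norm x" for x
    proof -
      have "c / 20 * norm x \<le> c / 10 * norm x" using P(3) by (intro mult_right_mono) auto
      then show ?thesis using close[of x] by linarith
    qed
    ultimately show "essentially_invertible S"
      using essentially_invertible_perturb[OF S(1) _ P] by blast
  next
    assume "essentially_invertible S"
    moreover have "c / 2 * norm x \<le> norm (S' x)" if "P x = 0" for x
    proof -
      have "c / 20 * norm x \<le> c / 2 * norm x" using P(3) by (intro mult_right_mono) auto
      then show ?thesis
        using P(4)[OF that] close[of x] norm_triangle_ineq2[of "S x" "S' x"] by simp
    qed
    moreover have "norm (S' x - S x) \<le> c / 2 / 10 * norm x" for x
      using close[of x] by (simp add: norm_minus_commute)
    ultimately show "essentially_invertible S'"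
      using essentially_invertible_perturb[OF S' _ P(1,2), of S "c / 2"] P(3) by simp
  qed
  then show thesis using that[of "c / 20"] P(3) by simp
qed

text \<open>Along the ray \<open>l + t u\<close> the operators \<open>T - (l + t u)\<close> stay bounded below on subspaces of finite
  codimension. Rescaled to \<open>(1 - s) (T - l) - s u\<close> with \<open>s = t / (1 + t)\<close> they form a path that ends,
  at \<open>s = 1\<close>, in the invertible operator \<open>- u\<close>.\<close>

lemma essentially_invertible_if_ray_avoids:
  fixes T :: "'a::complex_banach \<Rightarrow> 'a"
  assumes T: "bounded_clinear T" and u: "u \<noteq> 0"
    and ray: "\<And>t::real. t \<ge> 0 \<Longrightarrow> l + of_real t * u \<notin> essential_approximate_spectrum T"
  shows "essentially_invertible (\<lambda>x. T x - l *\<^sub>C x)"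
proof -
  define S where "S s x = of_real (1 - s) *\<^sub>C (T x - l *\<^sub>C x) - of_real s *\<^sub>C u *\<^sub>C x" for s :: real and x
  have lin: "bounded_clinear (S s)" for s
    unfolding S_def by (intro bounded_clinear_intros T)
  have below: "essentially_bounded_below (S s)" if s: "s \<in> {0..1}" for s
  proof (cases "s = 1")
    case True
    then have "S s x = - (u *\<^sub>C x)" for x by (simp add: S_def scaleC.zero_left scaleC_one)
    then show ?thesis
      using u by (intro bounded_below_imp_essentially_bounded_below[where c = "cmod u"]) (auto simp: norm_scaleC)
  next
    case False
    then have s: "0 \<le> s" "s < 1" using s by auto
    define k where "k = l + of_real (s / (1 - s)) * u"
    have "essentially_bounded_below (\<lambda>x. T x - k *\<^sub>C x)"
      using ray[of "s / (1 - s)"] s by (simp add: essential_approximate_spectrum_def k_def)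
    then obtain P c where P: "P \<in> compact_operators" "\<And>x. P (P x) = P x" "c > 0"
      "\<And>x. P x = 0 \<Longrightarrow> c * norm x \<le> norm (T x - k *\<^sub>C x)"
      using essentially_bounded_belowE by blast
    have S_eq: "S s x = of_real (1 - s) *\<^sub>C (T x - k *\<^sub>C x)" for x
    proof -
      have "of_real (1 - s) * k = of_real (1 - s) * l + of_real s * u"
      proof -
        have "of_real (1 - s) * of_real (s / (1 - s)) = (of_real s :: complex)"
          using s by (simp flip: of_real_mult)
        then show ?thesis unfolding k_def by (simp only: distrib_left flip: mult.assoc)
      qed
      then show ?thesis
        by (simp add: S_def scaleC.diff_right scaleC_scaleC scaleC_add_left)
    qed
    have "(1 - s) * c * norm x \<le> norm (S s x)" if "P x = 0" for x
    proof -
      have "norm (S s x) = (1 - s) * norm (T x - k *\<^sub>C x)"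
        unfolding S_eq norm_scaleC norm_of_real using s by simp
      then show ?thesis using P(4)[OF that] s by (simp add: mult.assoc mult_left_mono)
    qed
    then show ?thesis
      using P(3) s by (intro essentially_bounded_belowI[OF P(1,2), where c = "(1 - s) * c"]) auto
  qed
  have diff: "bounded_clinear (\<lambda>x. (T x - l *\<^sub>C x) + u *\<^sub>C x)"
    by (intro bounded_clinear_intros T)
  obtain M where M: "M > 0" "\<And>x. norm ((T x - l *\<^sub>C x) + u *\<^sub>C x) \<le> M * norm x"
    using bounded_clinear_pos_bound[OF diff] by blast
  have "essentially_invertible (S 0) = essentially_invertible (S 1)"
  proof (rule connected_local_const[of "{0..1::real}"])
    show "\<forall>s\<in>{0..1}. eventually (\<lambda>r. essentially_invertible (S s) = essentially_invertible (S r)) (at s within {0..1})"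
    proof
      fix s :: real assume s: "s \<in> {0..1}"
      obtain d where d: "d > 0" "\<And>S'. bounded_clinear S' \<Longrightarrow> (\<And>x. norm (S s x - S' x) \<le> d * norm x)
          \<Longrightarrow> essentially_invertible (S s) \<longleftrightarrow> essentially_invertible S'"
        using essentially_invertible_locally_constant[OF lin below[OF s]] by blast
      have "essentially_invertible (S s) = essentially_invertible (S r)" if r: "dist r s < d / M" for r
      proof (rule d(2)[OF lin])
        fix x
        have "S s x - S r x = of_real (r - s) *\<^sub>C ((T x - l *\<^sub>C x) + u *\<^sub>C x)"
          by (simp add: S_def scaleC_add_right scaleC.diff_left scaleC.diff_right scaleC_one)
        then have "norm (S s x - S r x) = \<bar>r - s\<bar> * norm ((T x - l *\<^sub>C x) + u *\<^sub>C x)"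
          by (simp only: norm_scaleC norm_of_real)
        also have "\<dots> \<le> (d / M) * (M * norm x)"
          using r M by (intro mult_mono) (auto simp: dist_norm)
        also have "\<dots> = d * norm x" using M(1) by simp
        finally show "norm (S s x - S r x) \<le> d * norm x" .
      qed
      then show "eventually (\<lambda>r. essentially_invertible (S s) = essentially_invertible (S r)) (at s within {0..1})"
        unfolding eventually_at using d(1) M(1) by (intro exI[of _ "d / M"]) auto
    qed
  qed auto
  moreover have "S 0 = (\<lambda>x. T x - l *\<^sub>C x)" by (simp add: fun_eq_iff S_def scaleC_one scaleC.zero_left)
  moreover have "essentially_invertible (S 1)"
    unfolding essentially_invertible_def
  proof (intro conjI exI[of _ "\<lambda>x. (-1/u) *\<^sub>C x"] lin)
    show "bounded_clinear (\<lambda>x. (-1/u) *\<^sub>C x :: 'a)" by (intro bounded_clinear_intros)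
    have "(-1/u) *\<^sub>C S 1 x - x = 0" "S 1 ((-1/u) *\<^sub>C x) - x = 0" for x
      using u by (simp_all add: S_def scaleC.zero_left scaleC_one scaleC.minus_left scaleC.minus_right scaleC_scaleC)
    then show "(\<lambda>x. (-1/u) *\<^sub>C S 1 x - x) \<in> compact_operators"
      "(\<lambda>x. S 1 ((-1/u) *\<^sub>C x) - x) \<in> compact_operators"
      by (simp_all add: compact_operators_zero)
  qed
  ultimately show ?thesis by simp
qed

text \<open>A closed half-plane separates a point outside the hull from the hull, and the ray that leaves this
  point orthogonally to the boundary of the half-plane avoids the hull.\<close>

lemma essential_spectrum_subset_convex_hull:
  fixes T :: "'a::complex_banach \<Rightarrow> 'a"
  assumes T: "bounded_clinear T"
  shows "essential_spectrum T \<subseteq> convex hull (essential_approximate_spectrum T)"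
proof
  fix l assume l: "l \<in> essential_spectrum T"
  let ?H = "convex hull (essential_approximate_spectrum T)"
  show "l \<in> ?H"
  proof (rule ccontr)
    assume "l \<notin> ?H"
    moreover have "closed ?H"
      by (intro compact_imp_closed compact_convex_hull compact_essential_approximate_spectrum T)
    ultimately obtain a b where ab: "inner a l < b" "\<And>k. k \<in> ?H \<Longrightarrow> inner a k > b"
      using separating_hyperplane_closed_point[of ?H l] by auto
    \<comment> \<open>If \<open>a = 0\<close> then the hull is empty and every direction will do.\<close>
    define u where "u = (if a = 0 then 1 else - a)"
    have "l + of_real t * u \<notin> ?H" if t: "t \<ge> 0" for t :: real
    proof
      assume *: "l + of_real t * u \<in> ?H"
      have "inner a (of_real t * u) = t * inner a u" by (simp flip: scaleR_conv_of_real)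
      moreover have "inner a u \<le> 0" by (simp add: u_def)
      ultimately have "inner a (l + of_real t * u) \<le> inner a l"
        using t by (simp add: inner_add_right mult_nonneg_nonpos)
      then show False using ab(1) ab(2)[OF *] by simp
    qed
    then have "essentially_invertible (\<lambda>x. T x - l *\<^sub>C x)"
      using hull_subset[of "essential_approximate_spectrum T" convex]
      by (intro essentially_invertible_if_ray_avoids[where u = u] T) (auto simp: u_def)
    then show False using essential_spectrum_not_essentially_invertible[OF T l] by simp
  qed
qed

section \<open>From approximate eigenvectors to the essential numerical range\<close>

text \<open>This turns failure of boundedness from below on subspaces of finite codimension into approximate
  eigenvectors annihilated by prescribed functionals, as weak convergence to \<open>0\<close> demands.\<close>

lemma finite_functionals_compact_projection:
  assumes "finite G" "G \<subseteq> (dual_space :: ('a::complex_normed_vector \<Rightarrow> complex) set)"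
  shows "\<exists>P\<in>compact_operators. (\<forall>x::'a. P (P x) = P x) \<and> (\<forall>g\<in>G. \<forall>x. P x = 0 \<longrightarrow> g x = 0)"
  using assms
proof (induction G rule: finite_induct)
  case empty
  show ?case by (intro bexI[OF _ compact_operators_zero]) auto
next
  case (insert g G)
  then obtain P :: "'a \<Rightarrow> 'a" where P: "P \<in> compact_operators" "\<And>x. P (P x) = P x"
    "\<And>h x. h \<in> G \<Longrightarrow> P x = 0 \<Longrightarrow> h x = 0" by auto
  have g: "bounded_clinear g" using insert.prems by simp
  have linP: "bounded_clinear P" using P(1) by (rule compact_operators_bounded_clinear)
  show ?case
  proof (cases "\<forall>x. P x = 0 \<longrightarrow> g x = 0")
    case True
    then show ?thesis using P by blast
  next
    case False
    then obtain v where v: "P v = 0" "g v \<noteq> 0" by blast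
    define e where "e = (1 / g v) *\<^sub>C v"
    have e: "P e = 0" "g e = 1"
      using v by (simp_all add: e_def bounded_clinear_scaleC[OF linP] bounded_clinear_scaleC[OF g]
          scaleC.zero_right scaleC_complex_def)
    define Q where "Q x = P x + g (x - P x) *\<^sub>C e" for x
    have PQ: "P (Q x) = P x" for x
      by (simp add: Q_def bounded_clinear_simps[OF linP] P(2) e scaleC.zero_right)
    have gQ: "g (Q x) = g x" for x
      by (simp add: Q_def bounded_clinear_simps[OF g] e scaleC_complex_def)
    have "Q \<in> compact_operators"
    proof -
      have "bounded_clinear (\<lambda>x. g (x - P x))"
        by (rule bounded_clinear_comp[OF g bounded_clinear_minus[OF bounded_clinear_id linP]])
      then show ?thesis
        unfolding Q_def by (intro compact_operators_plus P(1) compact_operators_rank_one) simp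
    qed
    moreover have "Q (Q x) = Q x" for x
    proof -
      have Q_eq: "Q y = P y + (g y - g (P y)) *\<^sub>C e" for y
        by (simp add: Q_def bounded_clinear_diff[OF g])
      have "Q (Q x) = P (Q x) + (g (Q x) - g (P (Q x))) *\<^sub>C e" by (rule Q_eq)
      also have "\<dots> = Q x" unfolding PQ gQ by (rule Q_eq[symmetric])
      finally show ?thesis .
    qed
    moreover have "h x = 0" if "h \<in> insert g G" "Q x = 0" for h x
    proof -
      have "P x = 0" using PQ[of x] that(2) by (simp add: bounded_clinear_zero[OF linP])
      moreover have "g x = 0" using gQ[of x] that(2) by (simp add: bounded_clinear_zero[OF g])
      ultimately show ?thesis using that(1) P(3) by blast
    qed
    ultimately show ?thesis by blast
  qed
qed

lemma approximate_eigenvector: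
  fixes T :: "'a::complex_normed_vector \<Rightarrow> 'a"
  assumes T: "bounded_clinear T" and l: "l \<in> essential_approximate_spectrum T"
    and G: "finite G" "G \<subseteq> dual_space" and e: "e > 0"
  obtains x where "norm x = 1" "\<And>g. g \<in> G \<Longrightarrow> g x = 0" "norm (T x - l *\<^sub>C x) < e"
proof -
  obtain P :: "'a \<Rightarrow> 'a" where P: "P \<in> compact_operators" "\<And>x. P (P x) = P x"
    "\<And>g x. g \<in> G \<Longrightarrow> P x = 0 \<Longrightarrow> g x = 0"
    using finite_functionals_compact_projection[OF G] by blast
  have "\<not> essentially_bounded_below (\<lambda>x. T x - l *\<^sub>C x)"
    using l by (simp add: essential_approximate_spectrum_def)
  then obtain v where v: "P v = 0" "norm (T v - l *\<^sub>C v) < e * norm v"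
    using essentially_bounded_belowI[OF P(1,2) e] by (meson not_le)
  then have v0: "v \<noteq> 0" using e bounded_clinear_zero[OF T] by (auto simp: scaleC.zero_right)
  have sgn: "sgn v = of_real (1 / norm v) *\<^sub>C v"
    unfolding sgn_div_norm by (simp add: scaleR_scaleC inverse_eq_divide)
  show thesis
  proof
    show "norm (sgn v) = 1" using v0 by (simp add: norm_sgn)
    show "g (sgn v) = 0" if "g \<in> G" for g
      using P(3)[OF that v(1)] that G(2) unfolding sgn
      by (auto simp: bounded_clinear_scaleC scaleC_complex_def)
    have "T (sgn v) - l *\<^sub>C sgn v = of_real (1 / norm v) *\<^sub>C (T v - l *\<^sub>C v)"
      unfolding sgn bounded_clinear_scaleC[OF T] by (simp add: scaleC.diff_right scaleC_scaleC mult.commute)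
    then have "norm (T (sgn v) - l *\<^sub>C sgn v) = norm (T v - l *\<^sub>C v) / norm v"
      by (simp add: norm_scaleC norm_divide)
    also have "\<dots> < e" using v(2) v0 by (simp add: divide_simps)
    finally show "norm (T (sgn v) - l *\<^sub>C sgn v) < e" .
  qed
qed

text \<open>The constant \<open>C\<close> bounds the coordinate functionals on the span of the \<open>x l\<close>. It measures
  their linear independence.\<close>

definition approximate_eigensystem ::
    "('a::complex_normed_vector \<Rightarrow> 'a) \<Rightarrow> complex set \<Rightarrow> ('a \<Rightarrow> complex) set \<Rightarrow> real \<Rightarrow> real
      \<Rightarrow> (complex \<Rightarrow> 'a) \<Rightarrow> bool"
  where "approximate_eigensystem T I G e C x \<longleftrightarrow>
    (\<forall>l\<in>I. (\<forall>g\<in>G. g (x l) = 0) \<and> norm (T (x l) - l *\<^sub>C x l) < e) \<and>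
    (\<forall>a. \<forall>l\<in>I. cmod (a l) \<le> C * norm (\<Sum>l\<in>I. a l *\<^sub>C x l))"

text \<open>The point is that \<open>C\<close> is chosen before \<open>G\<close> and \<open>e\<close>. The vectors are constructed successively,
  each in the kernels of norming functionals of the earlier ones; the coordinates are then recovered
  one after the other, and each step costs a bounded factor.\<close>

lemma independent_approximate_eigenvectors:
  fixes T :: "'a::complex_normed_vector \<Rightarrow> 'a"
  assumes T: "bounded_clinear T" and "finite I" "I \<subseteq> essential_approximate_spectrum T"
  shows "\<exists>C\<ge>0. \<forall>G e. finite G \<and> G \<subseteq> dual_space \<and> e > 0 \<longrightarrow>
    (\<exists>x. approximate_eigensystem T I G e C x)"
  using assms(2,3)
proof (induction I rule: finite_induct)
  case empty
  show ?case by (rule exI[of _ 0]) (simp add: approximate_eigensystem_def)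
next
  case (insert j I)
  then obtain C where C: "C \<ge> 0" and IH: "\<And>G e. finite G \<Longrightarrow> G \<subseteq> dual_space \<Longrightarrow> e > 0 \<Longrightarrow>
    \<exists>x. approximate_eigensystem T I G e C x"
    by auto
  show ?case
  proof (intro exI[of _ "max 1 (2 * C)"] conjI allI impI)
    fix G and e :: real assume "finite G \<and> G \<subseteq> (dual_space :: ('a \<Rightarrow> complex) set) \<and> e > 0"
    then have G: "finite G" "G \<subseteq> (dual_space :: ('a \<Rightarrow> complex) set)" and e: "e > 0" by auto
    obtain v where v: "norm v = 1" "\<And>g. g \<in> G \<Longrightarrow> g v = 0" "norm (T v - j *\<^sub>C v) < e"
      using approximate_eigenvector[OF T _ G e, of j] insert.prems by blast
    \<comment> \<open>The vectors for \<open>I\<close> are found after \<open>v\<close>, in the kernel of \<open>h\<close>; so \<open>h\<close> reads off the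
      coordinate of \<open>v\<close>.\<close>
    obtain h where h: "h \<in> dual_space" "\<And>z. cmod (h z) \<le> norm z" "h v = 1"
      using norming_functional[of v] v(1) by auto
    have linh: "bounded_clinear h" using h(1) by simp
    obtain x where "approximate_eigensystem T I (insert h G) e C x"
      using IH[of "insert h G" e] G h(1) e by auto
    then have x: "\<And>l g. l \<in> I \<Longrightarrow> g \<in> insert h G \<Longrightarrow> g (x l) = 0"
      "\<And>l. l \<in> I \<Longrightarrow> norm (T (x l) - l *\<^sub>C x l) < e"
      "\<And>a l. l \<in> I \<Longrightarrow> cmod (a l) \<le> C * norm (\<Sum>l\<in>I. a l *\<^sub>C x l)"
      unfolding approximate_eigensystem_def by blast+
    define y where "y = x(j := v)"
    have sum: "(\<Sum>l\<in>insert j I. a l *\<^sub>C y l) = a j *\<^sub>C v + (\<Sum>l\<in>I. a l *\<^sub>C x l)" for a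
    proof -
      have "(\<Sum>l\<in>I. a l *\<^sub>C y l) = (\<Sum>l\<in>I. a l *\<^sub>C x l)"
        using insert.hyps(2) by (intro sum.cong) (auto simp: y_def)
      then show ?thesis using insert.hyps by (simp add: y_def)
    qed
    have "cmod (a l) \<le> max 1 (2 * C) * norm (\<Sum>l\<in>insert j I. a l *\<^sub>C y l)" if l: "l \<in> insert j I" for a l
    proof -
      let ?w = "\<Sum>l\<in>insert j I. a l *\<^sub>C y l"
      have "h ?w = a j"
        unfolding sum using x(1)[where g = h]
        by (simp add: bounded_clinear_add[OF linh] bounded_clinear_scaleC[OF linh]
            bounded_clinear_sum[OF linh] h(3) scaleC_complex_def)
      then have aj: "cmod (a j) \<le> norm ?w" using h(2)[of ?w] by simp
      show ?thesis
      proof (cases "l = j")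
        case True
        then show ?thesis using aj mult_right_mono[of 1 "max 1 (2 * C)" "norm ?w"] by simp
      next
        case False
        have "norm (\<Sum>l\<in>I. a l *\<^sub>C x l) = norm (?w - a j *\<^sub>C v)" unfolding sum by simp
        also have "\<dots> \<le> norm ?w + cmod (a j)"
          using norm_triangle_ineq4[of ?w "a j *\<^sub>C v"] v(1) by (simp add: norm_scaleC)
        also have "\<dots> \<le> 2 * norm ?w" using aj by simp
        finally have "C * norm (\<Sum>l\<in>I. a l *\<^sub>C x l) \<le> C * (2 * norm ?w)"
          using C by (rule mult_left_mono)
        moreover have "cmod (a l) \<le> C * norm (\<Sum>l\<in>I. a l *\<^sub>C x l)" using x(3)[of l a] l False by simp
        moreover have "C * (2 * norm ?w) \<le> max 1 (2 * C) * norm ?w"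
          using mult_right_mono[of "2 * C" "max 1 (2 * C)" "norm ?w"] by simp
        ultimately show ?thesis by linarith
      qed
    qed
    moreover have "(\<forall>g\<in>G. g (y l) = 0) \<and> norm (T (y l) - l *\<^sub>C y l) < e" if "l \<in> insert j I" for l
      using that v x(1,2) by (auto simp: y_def)
    ultimately show "\<exists>x. approximate_eigensystem T (insert j I) G e (max 1 (2 * C)) x"
      unfolding approximate_eigensystem_def by (intro exI[of _ y]) blast
  qed simp
qed

text \<open>Zenger's lemma, applied to approximate eigenvectors with the weights of the convex combination.
  The points of weight \<open>0\<close> are dropped first, because Zenger's lemma needs positive weights. The
  coefficients \<open>z l\<close> are bounded by \<open>C\<close>, so the errors of the eigenvectors add up to at most
  \<open>card I * C * d\<close>.\<close>

lemma approximate_numerical_value: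
  fixes T :: "'a::complex_normed_vector \<Rightarrow> 'a"
  assumes T: "bounded_clinear T" and c: "c \<in> convex hull (essential_approximate_spectrum T)"
    and G: "finite G" "G \<subseteq> dual_space" and e: "e > 0"
  shows "\<exists>v F. (v, F) \<in> normed_pairs \<and> (\<forall>g\<in>G. g v = 0) \<and> cmod (F (T v) - c) < e"
proof -
  obtain A p where A: "finite A" "A \<subseteq> essential_approximate_spectrum T" "\<And>l. l \<in> A \<Longrightarrow> p l \<ge> 0"
    "sum p A = 1" "(\<Sum>l\<in>A. p l *\<^sub>R l) = c"
    using c unfolding convex_hull_explicit by blast
  define I where "I = {l \<in> A. p l \<noteq> 0}"
  have I: "finite I" "I \<subseteq> essential_approximate_spectrum T" "\<And>l. l \<in> I \<Longrightarrow> p l > 0"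
    using A(1,2,3) by (auto simp: I_def order_less_le)
  have sum1: "sum p I = 1"
  proof -
    have "sum p A = sum p I" by (rule sum.mono_neutral_right[OF A(1)]) (auto simp: I_def)
    then show ?thesis using A(4) by simp
  qed
  have sumc: "(\<Sum>l\<in>I. of_real (p l) * l) = c"
  proof -
    have "(\<Sum>l\<in>A. p l *\<^sub>R l) = (\<Sum>l\<in>I. p l *\<^sub>R l)"
      by (rule sum.mono_neutral_right[OF A(1)]) (auto simp: I_def)
    then show ?thesis using A(5) by (simp add: scaleR_conv_of_real)
  qed
  obtain C where C: "C \<ge> 0" and sys: "\<forall>G e. finite G \<and> G \<subseteq> dual_space \<and> e > 0 \<longrightarrow>
    (\<exists>x. approximate_eigensystem T I G e C x)"
    using independent_approximate_eigenvectors[OF T I(1,2)] by (elim exE conjE) (rule that)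
  define d where "d = e / (card I * C + 1)"
  have "card I * C + 1 > 0" using C by (simp add: add_nonneg_pos)
  then have d: "d > 0" "card I * C * d < e" using e by (simp_all add: d_def field_simps)
  obtain x where "approximate_eigensystem T I G d C x" using sys G d(1) by metis
  then have x: "\<And>l g. l \<in> I \<Longrightarrow> g \<in> G \<Longrightarrow> g (x l) = 0"
      "\<And>l. l \<in> I \<Longrightarrow> norm (T (x l) - l *\<^sub>C x l) < d"
      "\<And>a l. l \<in> I \<Longrightarrow> cmod (a l) \<le> C * norm (\<Sum>l\<in>I. a l *\<^sub>C x l)"
    by (simp_all add: approximate_eigensystem_def)
  obtain z F where z: "((\<Sum>l\<in>I. z l *\<^sub>C x l), F) \<in> normed_pairs"
    "\<And>v. cmod (F v) \<le> norm v" "\<And>l. l \<in> I \<Longrightarrow> z l * F (x l) = p l"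
    using zenger[OF I(1,3) sum1 x(3)] by blast
  define v where "v = (\<Sum>l\<in>I. z l *\<^sub>C x l)"
  have linF: "bounded_clinear F" and v1: "norm v = 1" using z(1) by (auto simp: normed_pairs_def v_def)
  have zC: "cmod (z l) \<le> C" if "l \<in> I" for l using x(3)[OF that, of z] v1 by (simp add: v_def)
  have "F (T v) - c = (\<Sum>l\<in>I. z l * F (T (x l) - l *\<^sub>C x l))"
  proof -
    have "F (T v) = (\<Sum>l\<in>I. z l * F (T (x l)))"
      by (simp add: v_def bounded_clinear_sum[OF T] bounded_clinear_scaleC[OF T]
          bounded_clinear_sum[OF linF] bounded_clinear_scaleC[OF linF] scaleC_complex_def)
    moreover have "c = (\<Sum>l\<in>I. z l * (l * F (x l)))"
      unfolding sumc[symmetric] by (intro sum.cong refl) (simp flip: z(3))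
    ultimately show ?thesis
      by (simp add: sum_subtractf[symmetric] right_diff_distrib bounded_clinear_diff[OF linF]
          bounded_clinear_scaleC[OF linF] scaleC_complex_def)
  qed
  also have "cmod \<dots> \<le> (\<Sum>l\<in>I. C * d)"
  proof (rule sum_norm_le)
    fix l assume l: "l \<in> I"
    have "cmod (F (T (x l) - l *\<^sub>C x l)) \<le> d"
      using z(2)[of "T (x l) - l *\<^sub>C x l"] x(2)[OF l] by linarith
    then show "cmod (z l * F (T (x l) - l *\<^sub>C x l)) \<le> C * d"
      unfolding norm_mult using zC[OF l] C by (intro mult_mono) auto
  qed
  also have "\<dots> < e" using d(2) by simp
  finally have "cmod (F (T v) - c) < e" .
  moreover have "g v = 0" if "g \<in> G" for g
  proof -
    have "bounded_clinear g" using that G(2) by auto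
    then show ?thesis
      using x(1)[OF _ that]
      by (simp add: v_def bounded_clinear_sum bounded_clinear_scaleC scaleC_complex_def)
  qed
  ultimately show ?thesis using z(1) unfolding v_def by blast
qed

text \<open>The net is indexed by pairs of a finite set of functionals, on which the vector is required to
  vanish, and a number that controls the error. Every functional vanishes on a tail of the net.\<close>

lemma convex_hull_approximate_spectrum_subset:
  fixes T :: "'a::complex_normed_vector \<Rightarrow> 'a"
  assumes T: "bounded_clinear T"
  shows "convex hull (essential_approximate_spectrum T) \<subseteq> essential_numerical_range T"
proof
  fix c assume c: "c \<in> convex hull (essential_approximate_spectrum T)"
  define D where "D = {G. finite G \<and> G \<subseteq> (dual_space :: ('a \<Rightarrow> complex) set)} \<times> (UNIV :: nat set)"
  define leq where "leq i j \<longleftrightarrow> fst i \<subseteq> fst j \<and> snd i \<le> snd j"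
    for i j :: "('a \<Rightarrow> complex) set \<times> nat"
  have "\<forall>i\<in>D. \<exists>q. q \<in> normed_pairs \<and> (\<forall>g\<in>fst i. g (fst q) = 0) \<and>
      cmod (snd q (T (fst q)) - c) < 1 / Suc (snd i)"
  proof
    fix i assume "i \<in> D"
    then obtain v F where "(v, F) \<in> normed_pairs" "\<forall>g\<in>fst i. g v = 0" "cmod (F (T v) - c) < 1 / Suc (snd i)"
      using approximate_numerical_value[OF T c, of "fst i" "1 / Suc (snd i)"] by (auto simp: D_def)
    then show "\<exists>q. q \<in> normed_pairs \<and> (\<forall>g\<in>fst i. g (fst q) = 0) \<and>
        cmod (snd q (T (fst q)) - c) < 1 / Suc (snd i)"
      by (intro exI[of _ "(v, F)"]) simp
  qed
  then obtain q where q: "\<forall>i\<in>D. q i \<in> normed_pairs \<and> (\<forall>g\<in>fst i. g (fst (q i)) = 0) \<and>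
      cmod (snd (q i) (T (fst (q i))) - c) < 1 / Suc (snd i)"
    by (rule bchoice[THEN exE])
  define x f where "x i = fst (q i)" and "f i = snd (q i)" for i
  have xf: "\<And>i. i \<in> D \<Longrightarrow> (x i, f i) \<in> normed_pairs"
    "\<And>i g. i \<in> D \<Longrightarrow> g \<in> fst i \<Longrightarrow> g (x i) = 0"
    "\<And>i. i \<in> D \<Longrightarrow> cmod (f i (T (x i)) - c) < 1 / Suc (snd i)"
    using q by (simp_all add: x_def f_def)
  have dir: "directed_by D leq"
    unfolding directed_by_def
  proof (intro conjI ballI impI)
    show "D \<noteq> {}" by (auto simp: D_def)
    fix i j assume "i \<in> D" "j \<in> D"
    then show "\<exists>k\<in>D. leq i k \<and> leq j k"
      by (intro bexI[of _ "(fst i \<union> fst j, max (snd i) (snd j))"]) (auto simp: D_def leq_def)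
  qed (auto simp: leq_def)
  have "ess_num_net T c D leq x f"
    unfolding ess_num_net_def weakly_tendsto_def
  proof (intro conjI ballI)
    fix g :: "'a \<Rightarrow> complex" assume g: "g \<in> dual_space"
    have "eventually (\<lambda>i. g (x i) = 0) (net_filter D leq)"
      unfolding eventually_net_filter[OF dir]
      using g xf(2) by (intro bexI[of _ "({g}, 0)"]) (auto simp: leq_def D_def)
    moreover have "g 0 = 0" using g by (simp add: bounded_clinear_zero)
    ultimately show "((\<lambda>i. g (x i)) \<longlongrightarrow> g 0) (net_filter D leq)"
      by (simp add: tendsto_eventually)
  next
    show "((\<lambda>i. f i (T (x i))) \<longlongrightarrow> c) (net_filter D leq)"
    proof (rule tendstoI)
      fix e :: real assume "e > 0"
      then obtain n where n: "1 / real (Suc n) < e"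
        using nat_approx_posE by blast
      have "dist (f j (T (x j))) c < e" if "j \<in> D" "leq ({}, n) j" for j
      proof -
        have "1 / real (Suc (snd j)) \<le> 1 / real (Suc n)"
          using that(2) by (intro divide_left_mono) (auto simp: leq_def)
        then show ?thesis using xf(3)[OF that(1)] n by (simp add: dist_norm)
      qed
      then show "eventually (\<lambda>i. dist (f i (T (x i))) c < e) (net_filter D leq)"
        unfolding eventually_net_filter[OF dir] by (intro bexI[of _ "({}, n)"]) (auto simp: D_def)
    qed
  qed (use dir xf(1) in auto)
  then show "c \<in> essential_numerical_range T" by (rule ess_num_net_imp_essential_numerical_range)
qed

theorem theorem1p12:
  fixes T :: "'a::complex_banach \<Rightarrow> 'a"
  assumes "bounded_clinear T"
  shows "convex hull (essential_spectrum T) \<subseteq> essential_numerical_range T"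
proof -
  have "convex hull (essential_spectrum T) \<subseteq> convex hull (essential_approximate_spectrum T)"
    using essential_spectrum_subset_convex_hull[OF assms] by (rule hull_minimal) simp
  also have "\<dots> \<subseteq> essential_numerical_range T"
    using assms by (rule convex_hull_approximate_spectrum_subset)
  finally show ?thesis .
qed

end
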